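(* Let $f>3$ be an integer with $\gcd(f,6)=1$ and let $m\in\{5,30,35,45,50,75,80\}$. Then there exists a simple $3-\bigl(2(2^f+1),6,(2^f-1)m\bigr)$ design.
   Context: A $t-(v,k,\lambda)$ design is a pair $(X,\mathcal B)$ with $|X|=v$ and $\mathcal B$ a collection of $k$-subsets (blocks) of $X$ such that every $t$-subset of $X$ is contained in exactly $\lambda$ blocks. It is simple if it has no repeated blocks. *)

theory Defs
  imports Main "HOL-Library.Multiset"
begin

text \<open>Blocks form a multiset, so that repeated blocks are allowed and counted with multiplicity.\<close>

definition is_design :: "nat \<Rightarrow> nat \<Rightarrow> nat \<Rightarrow> nat \<Rightarrow> 'a set \<Rightarrow> 'a set multiset \<Rightarrow> bool" where
  "is_design t v k l X B \<longleftrightarrow>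
     finite X \<and> card X = v \<and>
     (\<forall>b. b \<in># B \<longrightarrow> b \<subseteq> X \<and> card b = k) \<and>
     (\<forall>T. T \<subseteq> X \<and> card T = t \<longrightarrow> size {# b \<in># B. T \<subseteq> b #} = l)"

definition simple_blocks :: "'a set multiset \<Rightarrow> bool" where
  "simple_blocks B \<longleftrightarrow> (\<forall>b. count B b \<le> 1)"

end

theory Submission
  imports Defs "HOL-Algebra.Algebraic_Closure_Type" "HOL-Library.Z2"
begin

text \<open>
  Put \<open>q = 2 ^ f\<close> and let \<open>P\<close> be the projective line over the field with \<open>q\<close> elements, so that
  \<open>P\<close> has \<open>q + 1\<close> points and the group \<open>PGL\<close> of fractional linear maps is sharply 3-transitive on it.
  The design lives on two disjoint copies of \<open>P\<close> and has two kinds of blocks: 6-sets inside one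
  copy, and unions of a triple in the first copy with a triple in the second.

  The mixed blocks come from a resolution of the triples of \<open>P\<close>. A triple is the orbit of an
  element of order 3, which is unique up to inversion, and such an element moves every point of \<open>P\<close>;
  hence its orbits form a parallel class and every triple lies in exactly one of these classes
  (\<open>resolution_of_triples\<close>). Joining triples of the two copies whenever their classes are adjacent
  in a fixed \<open>m\<close>-regular graph covers every triple of points that meets both copies exactly
  \<open>m * (q - 1)\<close> times, and a triple inside one copy \<open>m * (q + 1) / 3\<close> times (\<open>doubled_design\<close>). The
  deficit inside a copy, \<open>2 * m * (q - 2) / 3\<close>, has to be supplied by a simple 3-design of 6-sets on \<open>P\<close>.

  Such designs are unions of \<open>PGL\<close>-orbits. The orbit of a 6-set whose stabilizer has \<open>s\<close> elements
  covers every triple \<open>120 / s\<close> times. The stabilizer acts freely on the 6-set, so \<open>s\<close> divides 6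
  and the index is 20 times some \<open>w\<close> with \<open>1 \<le> w \<le> 6\<close>. Orbits with \<open>w = 1\<close> exist: the stabilizer of a
  triple is a group of order 6 which acts freely on the other points, and its \<open>(q - 2) / 6\<close> regular orbits
  there are 6-sets in different \<open>PGL\<close>-orbits. Five of these make up whatever a greedy choice among
  the remaining orbits leaves over, so every multiple of 20 that is not too close to the
  total index \<open>(q - 2) choose 3\<close> is the index of some union of orbits (\<open>six_set_designs\<close>). For
  \<open>m = 5 * k\<close> the deficit is \<open>20 * k * (q - 2) / 6\<close>, a multiple of 20 because the \<open>q - 2\<close> points outside a
  triple split into sets of size 6, and it is small enough for \<open>k \<le> 16\<close>.

  The freeness statements all follow from one rigidity property (\<open>PGL_rigid\<close>): a fractional
  linear map that fixes a point and preserves a set of 3 or 5 other points is the identity. With the fixed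
  point at infinity the map is affine, it fixes the sum of the preserved set because the characteristic
  is two, and its multiplier is a root of unity of order at most 5; since \<open>f\<close> is odd,
  \<open>q - 1\<close> is prime to 2, 3 and 5, and the multiplier is 1 (\<open>affine_fixing_odd_set\<close>).
\<close>

text \<open>In ring theory \<open>X\<close> denotes the indeterminate; here it names the point set of a design.\<close>

no_notation var (\<open>X\<index>\<close>)

section \<open>Counting by fibres and subset sums\<close>

lemma card_eq_sum_card_fibres:
  assumes "finite A" "finite Y" "f ` A \<subseteq> Y"
  shows "card A = (\<Sum>y\<in>Y. card {x \<in> A. f x = y})"
  using sum.group[OF assms, of "\<lambda>_. 1::nat"] by simp

lemma card_eq_mult_card_fibres:
  assumes "finite A" "finite Y" "f ` A \<subseteq> Y"
    and "\<And>y. y \<in> Y \<Longrightarrow> card {x \<in> A. f x = y} = k"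
  shows "card A = k * card Y"
  using card_eq_sum_card_fibres[OF assms(1-3)] assms(4) by simp

text \<open>
  Adding elements one at a time and stopping before \<open>M\<close> is exceeded leaves a gap smaller than the
  largest weight.
\<close>

lemma subset_sum_just_below:
  fixes w :: "'b \<Rightarrow> nat"
  assumes "finite A" "\<And>a. a \<in> A \<Longrightarrow> w a \<le> Suc d" "M \<le> sum w A"
  shows "\<exists>B\<subseteq>A. sum w B \<le> M \<and> M \<le> sum w B + d"
  using assms
proof (induction A rule: finite_induct)
  case empty
  then show ?case by simp
next
  case (insert a A)
  show ?case
  proof (cases "M \<le> sum w A")
    case True
    then obtain B where "B \<subseteq> A" "sum w B \<le> M \<and> M \<le> sum w B + d"
      using insert.IH insert.prems by auto
    then show ?thesis by blast
  next
    case less: False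
    show ?thesis
    proof (cases "M = sum w (insert a A)")
      case True
      then show ?thesis by (intro exI[of _ "insert a A"]) simp
    next
      case False
      have "sum w (insert a A) = w a + sum w A" using insert.hyps by simp
      moreover have "w a \<le> Suc d" using insert.prems(1) by simp
      ultimately have "M \<le> sum w A + d" using False insert.prems(2) by linarith
      then show ?thesis using less by (intro exI[of _ A]) auto
    qed
  qed
qed

text \<open>The gap left by the greedy choice is filled with elements of weight 1 that were set aside.\<close>

lemma subset_sum_with_units:
  fixes w :: "'b \<Rightarrow> nat"
  assumes fin: "finite A" and w: "\<And>a. a \<in> A \<Longrightarrow> w a \<le> Suc d"
    and U: "U \<subseteq> A" "card U = d" "\<And>u. u \<in> U \<Longrightarrow> w u = 1"
    and M: "M + d \<le> sum w A"
  shows "\<exists>B\<subseteq>A. sum w B = M"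
proof -
  have fU: "finite U" using U(1) fin finite_subset by blast
  have "sum w U = d" using U by simp
  then have "M \<le> sum w (A - U)"
    using sum.subset_diff[OF U(1) fin, of w] M by linarith
  then obtain B where B: "B \<subseteq> A - U" "sum w B \<le> M" "M \<le> sum w B + d"
    using subset_sum_just_below[of "A - U" w d M] fin w by blast
  have "M - sum w B \<le> card U" using B(3) U(2) by simp
  then obtain V where V: "V \<subseteq> U" "card V = M - sum w B"
    by (rule obtain_subset_with_card_n)
  have fin': "finite B" "finite V"
    using B(1) V(1) fin fU by (auto intro: finite_subset)
  have "B \<inter> V = {}" using B(1) V(1) by blast
  then have "sum w (B \<union> V) = sum w B + sum w V" by (rule sum.union_disjoint[OF fin'])
  also have "sum w V = card V" using V(1) U(3) by (simp add: subset_iff)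
  finally have "sum w (B \<union> V) = M" using V(2) B(2) by simp
  moreover have "B \<union> V \<subseteq> A" using B(1) V(1) U(1) by blast
  ultimately show ?thesis by (intro exI conjI)
qed

section \<open>Doubling a resolvable triple system\<close>

text \<open>
  A set of blocks on any finite point set can be transported to natural numbers; the blocks of a
  set are distinct, so simplicity is automatic.
\<close>

lemma simple_design_on_nat:
  fixes X :: "'b set"
  assumes fin: "finite X" and v: "card X = v"
    and blocks: "\<And>b. b \<in> \<B> \<Longrightarrow> b \<subseteq> X \<and> card b = k"
    and count: "\<And>T. T \<subseteq> X \<Longrightarrow> card T = t \<Longrightarrow> card {b \<in> \<B>. T \<subseteq> b} = l"
  shows "\<exists>(Y :: nat set) B. is_design t v k l Y B \<and> simple_blocks B"
proof -
  obtain h where h: "bij_betw h X {0..<v}"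
    using ex_bij_betw_finite_nat[OF fin] v by auto
  then have inj: "inj_on h X" and img: "h ` X = {0..<v}"
    by (auto simp: bij_betw_def)
  define \<B>' where "\<B>' = (`) h ` \<B>"
  have "\<B> \<subseteq> Pow X" using blocks by auto
  then have fB: "finite \<B>'"
    unfolding \<B>'_def using fin finite_subset by blast
  have injB: "inj_on ((`) h) (Pow X)"
    using inj by (simp add: inj_on_image_Pow)
  have "is_design t v k l {0..<v} (mset_set \<B>')"
    unfolding is_design_def
  proof (intro conjI allI impI)
    fix b assume "b \<in># mset_set \<B>'"
    then obtain c where c: "c \<in> \<B>" "b = h ` c" using fB by (auto simp: \<B>'_def)
    then show "b \<subseteq> {0..<v}" using blocks img by blast
    show "card b = k"
      using c blocks[OF c(1)] inj by (metis card_image inj_on_subset)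
  next
    fix T assume T: "T \<subseteq> {0..<v} \<and> card T = t"
    define S where "S = {x \<in> X. h x \<in> T}"
    have hS: "h ` S = T" using T img by (auto simp: S_def)
    have SX: "S \<subseteq> X" by (auto simp: S_def)
    have cS: "card S = t"
      using T hS SX inj by (metis card_image inj_on_subset)
    have "{b \<in> \<B>'. T \<subseteq> b} = (`) h ` {c \<in> \<B>. S \<subseteq> c}"
    proof -
      have "T \<subseteq> h ` c \<longleftrightarrow> S \<subseteq> c" if "c \<in> \<B>" for c
      proof
        assume "T \<subseteq> h ` c"
        show "S \<subseteq> c"
        proof
          fix x assume x: "x \<in> S"
          then have "h x \<in> h ` c" using \<open>T \<subseteq> h ` c\<close> hS by blast
          moreover have "x \<in> X" "c \<subseteq> X" using x SX blocks[OF that] by blast+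
          ultimately show "x \<in> c" using inj_on_image_mem_iff[OF inj] by blast
        qed
      qed (use hS in blast)
      then show ?thesis unfolding \<B>'_def by blast
    qed
    moreover have "card ((`) h ` {c \<in> \<B>. S \<subseteq> c}) = card {c \<in> \<B>. S \<subseteq> c}"
      by (rule card_image, rule inj_on_subset[OF injB]) (use blocks in auto)
    ultimately have "card {b \<in> \<B>'. T \<subseteq> b} = l"
      using count[OF SX cS] by simp
    then show "size {#b \<in># mset_set \<B>'. T \<subseteq> b#} = l"
      using fB by (simp add: filter_mset_mset_set)
  qed auto
  moreover have "simple_blocks (mset_set \<B>')"
    using fB by (simp add: simple_blocks_def count_mset_set')
  ultimately show ?thesis by blast
qed

text \<open>
  The residues \<open>(i + j) mod n\<close> with \<open>i\<close> fixed run once through \<open>{..<n}\<close>. So joining \<open>i\<close> and \<open>j\<close> when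
  \<open>(i + j) mod n < m\<close> gives a graph in which every vertex has \<open>m\<close> neighbours, loops included; its
  symmetry allows the two copies of the point set to be interchanged.
\<close>

lemma card_circulant_row:
  fixes i m n :: nat
  assumes "m \<le> n"
  shows "card {j. j < n \<and> (i + j) mod n < m} = m"
proof (cases "n = 0")
  case False
  have inj: "inj_on (\<lambda>j. (i + j) mod n) {..<n}"
  proof (rule linorder_inj_onI')
    fix a b assume ab: "a \<in> {..<n}" "b \<in> {..<n}" "a < b"
    show "(i + a) mod n \<noteq> (i + b) mod n"
    proof
      assume "(i + a) mod n = (i + b) mod n"
      then have "n dvd (i + b) - (i + a)" using ab mod_eq_dvd_iff_nat[of "i + a" "i + b" n] by simp
      then show False using ab by (auto dest: dvd_imp_le)
    qed
  qed
  have sub: "(\<lambda>j. (i + j) mod n) ` {..<n} = {..<n}"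
    by (rule endo_inj_surj[OF _ _ inj]) (use False in auto)
  have "(\<lambda>j. (i + j) mod n) ` {j. j < n \<and> (i + j) mod n < m} = {..<m}"
  proof -
    have "(\<lambda>j. (i + j) mod n) ` {j. j < n \<and> (i + j) mod n < m}
        = (\<lambda>j. (i + j) mod n) ` {..<n} \<inter> {..<m}" by auto
    also have "\<dots> = {..<n} \<inter> {..<m}" by (simp only: sub)
    also have "\<dots> = {..<m}" using assms by auto
    finally show ?thesis .
  qed
  moreover have "inj_on (\<lambda>j. (i + j) mod n) {j. j < n \<and> (i + j) mod n < m}"
    by (rule inj_on_subset[OF inj]) auto
  note card_image[OF this]
  ultimately show ?thesis by simp
qed (use assms in auto)

definition triples :: "'a set \<Rightarrow> 'a set set" where
  "triples P = {A. A \<subseteq> P \<and> card A = 3}"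

text \<open>
  The function \<open>cl\<close> colours the triples so that each of the \<open>n\<close> colour classes is a parallel class.
  A triple with two points in one copy and one in the other extends to a mixed block by choosing the
  third point of the first part (\<open>v - 2\<close> ways), one of the \<open>m\<close> adjacent classes, and in that class
  the only triple through the remaining point. A triple inside one copy is itself a part of the mixed
  blocks that contain it, and its partners are all triples of \<open>m\<close> classes with \<open>v / 3\<close> members each. The
  equation \<open>balance\<close> says that \<open>l\<close> further blocks inside the copy make the two counts equal.
\<close>

theorem doubled_design:
  fixes P :: "'a set" and cl :: "'a set \<Rightarrow> nat"
  assumes fin: "finite P" and v: "card P = v"
    and cl_less: "\<And>A. A \<in> triples P \<Longrightarrow> cl A < n"
    and parallel: "\<And>i x. i < n \<Longrightarrow> x \<in> P \<Longrightarrow> \<exists>!A. A \<in> triples P \<and> cl A = i \<and> x \<in> A"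
    and mn: "m \<le> n"
    and D: "\<And>b. b \<in> D \<Longrightarrow> b \<subseteq> P \<and> card b = 6"
    and count_D: "\<And>T. T \<in> triples P \<Longrightarrow> card {b \<in> D. T \<subseteq> b} = l"
    and balance: "3 * l + m * v = 3 * (m * (v - 2))"
  shows "\<exists>(X :: nat set) B. is_design 3 (2 * v) 6 ((v - 2) * m) X B \<and> simple_blocks B"
proof -
  define X where "X = P \<times> (UNIV :: bool set)"
  define emb where "emb s A = (\<lambda>x. (x, s)) ` A" for s :: bool and A :: "'a set"
  define adj where "adj A B \<longleftrightarrow> (cl A + cl B) mod n < m" for A B
  define pure where "pure = (\<Union>s. emb s ` D)"
  define join where "join A B = emb False A \<union> emb True B" for A B
  define mixed where "mixed = {join A B | A B. A \<in> triples P \<and> B \<in> triples P \<and> adj A B}"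
  have adj_sym: "adj A B \<longleftrightarrow> adj B A" for A B by (simp add: adj_def add.commute)
  have card_emb: "card (emb s A) = card A" for s A
    unfolding emb_def by (rule card_image) (auto simp: inj_on_def)
  have emb_sub: "emb s A \<subseteq> emb s B \<longleftrightarrow> A \<subseteq> B" for s A B by (auto simp: emb_def)
  have emb_inj: "emb s A = emb s B \<longleftrightarrow> A = B" for s A B using emb_sub by blast
  have emb_mem: "(x, t) \<in> emb s A \<longleftrightarrow> t = s \<and> x \<in> A" for x t s A by (auto simp: emb_def)
  have join_mem: "(x, t) \<in> join A B \<longleftrightarrow> (if t then x \<in> B else x \<in> A)" for x t A B
    by (auto simp: join_def emb_mem)
  have join_inj: "join A B = join A' B' \<longleftrightarrow> A = A' \<and> B = B'" for A B A' B'
  proof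
    assume e: "join A B = join A' B'"
    have "x \<in> A \<longleftrightarrow> x \<in> A'" "x \<in> B \<longleftrightarrow> x \<in> B'" for x
      using join_mem[of x False A B] join_mem[of x False A' B']
        join_mem[of x True A B] join_mem[of x True A' B'] e by auto
    then show "A = A' \<and> B = B'" by blast
  qed simp
  have fin_tri: "finite (triples P)"
    using fin by (simp add: triples_def)
  have tri3: "card A = 3" "finite A" "A \<subseteq> P" if "A \<in> triples P" for A
    using that fin by (auto simp: triples_def intro: finite_subset)
  have "D \<subseteq> Pow P" using D by blast
  then have finD: "finite D" using fin finite_subset by blast

  have card_join: "card (join A B) = 6" if "A \<in> triples P" "B \<in> triples P" for A B
  proof -
    have "emb False A \<inter> emb True B = {}" by (auto simp: emb_def)
    moreover have "finite (emb False A)" "finite (emb True B)"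
      using that tri3 by (auto simp: emb_def)
    ultimately show ?thesis
      using that tri3 by (simp add: join_def card_Un_disjoint card_emb)
  qed
  have mixed_not_pure: False if "b \<in> mixed" "b \<in> pure" for b
  proof -
    obtain A B where ab: "b = join A B" "A \<in> triples P" "B \<in> triples P"
      using \<open>b \<in> mixed\<close> by (auto simp: mixed_def)
    obtain s d where sd: "b = emb s d" using \<open>b \<in> pure\<close> by (auto simp: pure_def)
    have "A \<noteq> {}" "B \<noteq> {}" using ab tri3(1) by force+
    then obtain x y where "x \<in> A" "y \<in> B" by blast
    then have "(x, False) \<in> b" "(y, True) \<in> b" using ab by (auto simp: join_mem)
    then show False using sd by (auto simp: emb_mem)
  qed

  define row where "row A = {B \<in> triples P. adj A B}" for A
  have class_count: "card {B \<in> row A. x \<in> B} = m" if A: "A \<in> triples P" and x: "x \<in> P" for A x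
  proof -
    have "bij_betw cl {B \<in> row A. x \<in> B} {j. j < n \<and> (cl A + j) mod n < m}"
    proof (rule bij_betwI')
      fix B C assume "B \<in> {B \<in> row A. x \<in> B}" "C \<in> {B \<in> row A. x \<in> B}"
      then show "cl B = cl C \<longleftrightarrow> B = C"
        using parallel[OF cl_less x] unfolding row_def by blast
    next
      fix B assume "B \<in> {B \<in> row A. x \<in> B}"
      then show "cl B \<in> {j. j < n \<and> (cl A + j) mod n < m}"
        using cl_less by (auto simp: row_def adj_def)
    next
      fix j assume j: "j \<in> {j. j < n \<and> (cl A + j) mod n < m}"
      then obtain B where "B \<in> triples P" "cl B = j" "x \<in> B" using parallel x by blast
      then show "\<exists>B\<in>{B \<in> row A. x \<in> B}. j = cl B"
        using j by (auto simp: row_def adj_def)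
    qed
    then show ?thesis using card_circulant_row[OF mn, of "cl A"] by (simp add: bij_betw_same_card)
  qed
  have row_count: "3 * card (row A) = m * v" if A: "A \<in> triples P" for A
  proof -
    have "card {x \<in> P. x \<in> B} = 3" if "B \<in> row A" for B
      using tri3[of B] that by (simp add: row_def Collect_conj_eq Int_absorb1)
    then have "(\<Sum>x\<in>P. card {B \<in> row A. x \<in> B}) = 3 * card (row A)"
      using fin fin_tri by (intro sum_multicount) (auto simp: row_def)
    then show ?thesis using class_count[OF A] v by (simp add: mult.commute)
  qed

  have pure_count: "card {b \<in> pure. emb s A \<subseteq> b} = l" if A: "A \<in> triples P" for s A
  proof -
    have ne: "A \<noteq> {}" using tri3[OF A] by auto
    have "{b \<in> pure. emb s A \<subseteq> b} = emb s ` {b \<in> D. A \<subseteq> b}"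
    proof (intro equalityI subsetI)
      fix b assume b: "b \<in> {b \<in> pure. emb s A \<subseteq> b}"
      then obtain t d where td: "b = emb t d" "d \<in> D" by (auto simp: pure_def)
      moreover obtain x where "x \<in> A" using ne by blast
      then have "(x, s) \<in> b" using b by (auto simp: emb_mem)
      ultimately have "t = s" by (simp add: emb_mem)
      then show "b \<in> emb s ` {b \<in> D. A \<subseteq> b}" using td b emb_sub by blast
    next
      fix b assume "b \<in> emb s ` {b \<in> D. A \<subseteq> b}"
      then obtain d where "b = emb s d" "d \<in> D" "A \<subseteq> d" by blast
      then show "b \<in> {b \<in> pure. emb s A \<subseteq> b}" by (simp add: pure_def emb_sub) blast
    qed
    moreover have "card (emb s ` {b \<in> D. A \<subseteq> b}) = card {b \<in> D. A \<subseteq> b}"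
      by (rule card_image) (auto simp: inj_on_def emb_inj)
    ultimately show ?thesis using count_D[OF A] by simp
  qed
  have extend: "card {A \<in> triples P. {x, y} \<subseteq> A} = v - 2" if xy: "x \<in> P" "y \<in> P" "x \<noteq> y" for x y
  proof -
    have "{A \<in> triples P. {x, y} \<subseteq> A} = (\<lambda>z. {x, y, z}) ` (P - {x, y})"
    proof (intro equalityI subsetI)
      fix A assume A: "A \<in> {A \<in> triples P. {x, y} \<subseteq> A}"
      then have "card (A - {x, y}) = 1" using tri3 xy by (auto simp: card_Diff_subset)
      then obtain z where "A - {x, y} = {z}" by (auto simp: card_1_singleton_iff)
      moreover have "A \<subseteq> P" using A tri3(3) by blast
      ultimately show "A \<in> (\<lambda>z. {x, y, z}) ` (P - {x, y})"
        using A by (intro image_eqI[of _ _ z]) auto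
    qed (use xy in \<open>auto simp: triples_def card_insert_if\<close>)
    moreover have "inj_on (\<lambda>z. {x, y, z}) (P - {x, y})" by (auto simp: inj_on_def)
    ultimately show ?thesis using xy v fin by (simp add: card_image card_Diff_subset)
  qed
  have pairs_count: "card {(A, B). A \<in> triples P \<and> B \<in> row A \<and> {x, y} \<subseteq> A \<and> z \<in> B} = (v - 2) * m"
    if "x \<in> P" "y \<in> P" "x \<noteq> y" "z \<in> P" for x y z
  proof -
    have "{(A, B). A \<in> triples P \<and> B \<in> row A \<and> {x, y} \<subseteq> A \<and> z \<in> B}
        = (SIGMA A:{A \<in> triples P. {x, y} \<subseteq> A}. {B \<in> row A. z \<in> B})" by auto
    then show ?thesis using extend class_count that fin_tri
      by (simp add: card_SigmaI row_def)
  qed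

  have total: "card {b \<in> pure \<union> mixed. T \<subseteq> b} = card {b \<in> pure. T \<subseteq> b} + card {b \<in> mixed. T \<subseteq> b}" for T
  proof -
    have "finite pure" using finD by (simp add: pure_def)
    moreover have "mixed \<subseteq> (\<lambda>(A, B). join A B) ` (triples P \<times> triples P)"
      by (auto simp: mixed_def)
    then have "finite mixed" using fin_tri by (meson finite_SigmaI finite_imageI finite_subset)
    ultimately show ?thesis
      using mixed_not_pure by (subst card_Un_disjoint[symmetric]) (auto intro!: arg_cong[where f = card])
  qed

  have one_sided: "card {b \<in> mixed. emb s A \<subseteq> b} = card (row A)" if A: "A \<in> triples P" for s A
  proof -
    have eq: "B = A" if "B \<in> triples P" "A \<subseteq> B" for B
      using that A tri3 by (metis card_subset_eq)
    have "{b \<in> mixed. emb s A \<subseteq> b} = (\<lambda>B. if s then join B A else join A B) ` row A"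
    proof (intro equalityI subsetI)
      fix b assume "b \<in> {b \<in> mixed. emb s A \<subseteq> b}"
      then obtain B C where bc: "b = join B C" "B \<in> triples P" "C \<in> triples P" "adj B C" "emb s A \<subseteq> join B C"
        by (auto simp: mixed_def)
      then have "A \<subseteq> (if s then C else B)" by (auto simp: subset_iff emb_mem join_mem split: if_splits)
      then have "(if s then C else B) = A" using eq bc by (auto split: if_splits)
      then show "b \<in> (\<lambda>B. if s then join B A else join A B) ` row A"
        using bc adj_sym by (auto simp: row_def split: if_splits)
    next
      fix b assume "b \<in> (\<lambda>B. if s then join B A else join A B) ` row A"
      then show "b \<in> {b \<in> mixed. emb s A \<subseteq> b}"
        using A adj_sym by (auto simp: row_def mixed_def emb_mem join_mem join_inj emb_def split: if_splits)
    qed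
    moreover have "inj_on (\<lambda>B. if s then join B A else join A B) (row A)"
      by (auto simp: inj_on_def join_inj split: if_splits)
    ultimately show ?thesis by (simp only: card_image)
  qed
  have two_sided: "card {b \<in> pure \<union> mixed. {(x, s), (y, s), (z, \<not> s)} \<subseteq> b} = (v - 2) * m"
    if xyz: "x \<in> P" "y \<in> P" "x \<noteq> y" "z \<in> P" for s x y z
  proof -
    let ?T = "{(x, s), (y, s), (z, \<not> s)}"
    let ?Q = "{(A, B). A \<in> triples P \<and> B \<in> row A \<and> {x, y} \<subseteq> A \<and> z \<in> B}"
    let ?j = "\<lambda>(A, B). if s then join B A else join A B"
    have none: "{b \<in> pure. ?T \<subseteq> b} = {}" by (auto simp: pure_def emb_mem)
    have img: "{b \<in> mixed. ?T \<subseteq> b} = ?j ` ?Q"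
    proof (intro equalityI subsetI)
      fix b assume "b \<in> {b \<in> mixed. ?T \<subseteq> b}"
      then obtain B C where bc: "b = join B C" "B \<in> triples P" "C \<in> triples P" "adj B C" "?T \<subseteq> join B C"
        by (auto simp: mixed_def)
      then show "b \<in> ?j ` ?Q"
        using adj_sym by (intro image_eqI[of _ _ "if s then (C, B) else (B, C)"])
          (auto simp: row_def join_mem split: if_splits)
    next
      fix b assume "b \<in> ?j ` ?Q"
      then show "b \<in> {b \<in> mixed. ?T \<subseteq> b}"
        using adj_sym by (auto simp: row_def mixed_def join_mem join_inj split: if_splits)
    qed
    have inj: "inj_on ?j ?Q"
      by (auto simp: inj_on_def join_inj split: if_splits)
    have "card {b \<in> pure \<union> mixed. ?T \<subseteq> b} = card (?j ` ?Q)"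
      unfolding total none img by simp
    also have "\<dots> = card ?Q" by (rule card_image[OF inj])
    also have "\<dots> = (v - 2) * m" by (rule pairs_count[OF xyz])
    finally show ?thesis .
  qed

  have "card {b \<in> pure \<union> mixed. T \<subseteq> b} = (v - 2) * m" if T: "T \<subseteq> X" "card T = 3" for T
  proof -
    obtain p q r where pqr: "T = {p, q, r}" "p \<noteq> q" "q \<noteq> r" "p \<noteq> r"
      using T(2) unfolding card_3_iff by blast
    have mem: "fst p \<in> P" "fst q \<in> P" "fst r \<in> P" using T(1) pqr by (auto simp: X_def)
    note two = two_sided[of "fst p" "fst q" "fst r" "snd p"] two_sided[of "fst p" "fst r" "fst q" "snd p"]
      two_sided[of "fst q" "fst r" "fst p" "snd q"]
    consider "snd p = snd q" "snd r = snd p" | "snd p = snd q" "snd r \<noteq> snd p"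
      | "snd p = snd r" "snd q \<noteq> snd p" | "snd q = snd r" "snd p \<noteq> snd q" by blast
    then show ?thesis
    proof cases
      case 1
      let ?A = "{fst p, fst q, fst r}"
      have A: "?A \<in> triples P"
        using mem pqr 1 by (auto simp: triples_def card_insert_if prod_eq_iff)
      have "T = emb (snd p) ?A" using pqr 1 by (auto simp: emb_def prod_eq_iff)
      then show ?thesis
        using total[of T] pure_count[OF A] one_sided[OF A] row_count[OF A] balance by (simp add: mult.commute)
    next
      case 2
      then have "T = {(fst p, snd p), (fst q, snd p), (fst r, \<not> snd p)}" "fst p \<noteq> fst q"
        using pqr by (auto simp: prod_eq_iff)
      then show ?thesis using two(1) mem by simp
    next
      case 3
      then have "T = {(fst p, snd p), (fst r, snd p), (fst q, \<not> snd p)}" "fst p \<noteq> fst r"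
        using pqr by (auto simp: prod_eq_iff)
      then show ?thesis using two(2) mem by simp
    next
      case 4
      then have "T = {(fst q, snd q), (fst r, snd q), (fst p, \<not> snd q)}" "fst q \<noteq> fst r"
        using pqr by (auto simp: prod_eq_iff)
      then show ?thesis using two(3) mem by simp
    qed
  qed
  moreover have "b \<subseteq> X \<and> card b = 6" if "b \<in> pure \<union> mixed" for b
    using that
  proof
    assume "b \<in> pure"
    then obtain s d where "b = emb s d" "d \<in> D" by (auto simp: pure_def)
    then show ?thesis using D[of d] by (simp add: card_emb) (auto simp: X_def emb_def)
  next
    assume "b \<in> mixed"
    then obtain A B where AB: "b = join A B" "A \<in> triples P" "B \<in> triples P"
      by (auto simp: mixed_def)
    then have "b \<subseteq> X" using tri3(3)[of A] tri3(3)[of B] by (auto simp: X_def join_def emb_def)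
    then show ?thesis using AB card_join by simp
  qed
  moreover have "finite X" "card X = 2 * v"
    using fin v by (auto simp: X_def card_cartesian_product)
  ultimately show ?thesis
    by (intro simple_design_on_nat[of X "2 * v" "pure \<union> mixed"]) auto
qed

section \<open>Sharply 3-transitive groups: rotations and resolutions\<close>

text \<open>Ordered triples of distinct points, as lists so that a map acts on them by \<open>map\<close>.\<close>

definition frames :: "'a set \<Rightarrow> 'a list set" where
  "frames B = {xs. length xs = 3 \<and> distinct xs \<and> set xs \<subseteq> B}"

lemma frames_mono: "A \<subseteq> B \<Longrightarrow> xs \<in> frames A \<Longrightarrow> xs \<in> frames B"
  by (auto simp: frames_def)

lemma finite_frames: "finite B \<Longrightarrow> finite (frames B)"
  by (rule finite_subset[OF _ finite_lists_length_eq[of B 3]]) (auto simp: frames_def)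

lemma card_frames:
  assumes "finite B" "card B \<ge> 3"
  shows "card (frames B) = card B * (card B - 1) * (card B - 2)"
proof -
  obtain k where k: "card B = k + 3" using assms(2) le_Suc_ex by (metis add.commute)
  have "{k + 1..k + 3} = {k + 1, k + 2, k + 3}" by auto
  then show ?thesis
    using card_lists_distinct_length_eq[OF assms] by (simp add: frames_def k algebra_simps)
qed

abbreviation undo :: "('a \<Rightarrow> 'a) \<Rightarrow> 'a \<Rightarrow> 'a" where
  "undo g \<equiv> inv_into UNIV g"

text \<open>
  The group consists of maps on the whole type, so that its elements can be compared by plain equality.
  The sets \<open>A\<close> in \<open>rigid\<close> of interest are a triple and a 6-set without one of its points.
\<close>

locale sharply_3_transitive =
  fixes P :: "'a set" and G :: "('a \<Rightarrow> 'a) set"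
  assumes finite_P: "finite P" and card_P: "card P \<ge> 33"
    and bij: "g \<in> G \<Longrightarrow> bij g" and image_P: "g \<in> G \<Longrightarrow> g ` P = P"
    and id_in: "id \<in> G"
    and comp_in: "g \<in> G \<Longrightarrow> h \<in> G \<Longrightarrow> g \<circ> h \<in> G"
    and undo_in: "g \<in> G \<Longrightarrow> undo g \<in> G"
    and sharp: "xs \<in> frames P \<Longrightarrow> ys \<in> frames P \<Longrightarrow> \<exists>!g. g \<in> G \<and> map g xs = ys"
    and rigid: "\<lbrakk>g \<in> G; p \<in> P; g p = p; A \<subseteq> P - {p}; g ` A = A; card A = 3 \<or> card A = 5\<rbrakk> \<Longrightarrow> g = id"
begin

lemma inj: "g \<in> G \<Longrightarrow> g x = g y \<longleftrightarrow> x = y"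
  using bij by (metis bij_is_inj inj_eq)

lemma inj_G: "g \<in> G \<Longrightarrow> inj_on g A"
  by (simp add: inj_on_def inj)

lemma mem_P: "g \<in> G \<Longrightarrow> g x \<in> P \<longleftrightarrow> x \<in> P"
  using inj_image_mem_iff[OF bij_is_inj[OF bij], of g x P] image_P by simp

lemma undo_apply: "g \<in> G \<Longrightarrow> undo g (g x) = x"
  using bij by (simp add: bij_is_inj)

lemma apply_undo: "g \<in> G \<Longrightarrow> g (undo g x) = x"
  using bij by (simp add: bij_is_surj surj_f_inv_f)

lemma undo_image: "g \<in> G \<Longrightarrow> undo g ` (g ` A) = A"
  by (simp add: image_comp undo_apply)

lemma image_undo: "g \<in> G \<Longrightarrow> g ` (undo g ` A) = A"
  by (simp add: image_comp apply_undo)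

lemma card_image_G: "g \<in> G \<Longrightarrow> card (g ` A) = card A"
  by (simp add: card_image inj_G)

lemma map_frames: "g \<in> G \<Longrightarrow> xs \<in> frames A \<Longrightarrow> map g xs \<in> frames (g ` A)"
  using inj_G[of g "set xs"] by (auto simp: frames_def distinct_map)

lemma ex_map_frame:
  assumes "xs \<in> frames P" "ys \<in> frames P"
  obtains g where "g \<in> G" "map g xs = ys"
  using ex1_implies_ex[OF sharp[OF assms]] by (elim exE conjE)

lemma frame_eqI:
  assumes "g \<in> G" "h \<in> G" "xs \<in> frames P" "map g xs = map h xs"
  shows "g = h"
proof -
  have "map h xs \<in> frames P" using map_frames[OF assms(2,3)] image_P[OF assms(2)] by simp
  then show ?thesis using sharp[OF assms(3)] assms by blast
qed

lemma frame_fixed: "g \<in> G \<Longrightarrow> xs \<in> frames P \<Longrightarrow> map g xs = xs \<Longrightarrow> g = id"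
  by (rule frame_eqI[OF _ id_in]) auto

lemma ex_frame: obtains xs where "xs \<in> frames P"
proof -
  have "card (frames P) > 0" using card_frames[OF finite_P] card_P by simp
  then show thesis using that by (metis card.empty ex_in_conv less_irrefl)
qed

definition rotations :: "('a \<Rightarrow> 'a) set" where
  "rotations = {g \<in> G. g \<noteq> id \<and> g \<circ> g \<circ> g = id}"

definition cyc :: "('a \<Rightarrow> 'a) \<Rightarrow> 'a \<Rightarrow> 'a set" where
  "cyc g x = {x, g x, g (g x)}"

definition parallel_class :: "('a \<Rightarrow> 'a) \<Rightarrow> 'a set set" where
  "parallel_class g = cyc g ` P"

lemma rotationD:
  assumes "g \<in> rotations"
  shows "g \<in> G" "g (g (g x)) = x"
proof -
  show "g \<in> G" using assms by (simp add: rotations_def)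
  have "g \<circ> g \<circ> g = id" using assms by (simp add: rotations_def)
  then show "g (g (g x)) = x" by (metis comp_apply id_apply)
qed

lemma cyc_distinct:
  assumes g: "g \<in> rotations" and x: "g x \<noteq> x"
  shows "g (g x) \<noteq> g x" "g (g x) \<noteq> x"
proof -
  show "g (g x) \<noteq> g x" using x inj[OF rotationD(1)[OF g]] by simp
  show "g (g x) \<noteq> x"
  proof
    assume "g (g x) = x"
    then have "g (g (g x)) = g x" by (rule arg_cong)
    then have "g x = x" unfolding rotationD(2)[OF g] by (rule sym)
    then show False using x by contradiction
  qed
qed

lemma card_cyc:
  assumes "g \<in> rotations" "g x \<noteq> x"
  shows "card (cyc g x) = 3"
proof -
  note ne = assms(2) cyc_distinct[OF assms]
  show ?thesis by (simp add: cyc_def ne ne[symmetric])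
qed

lemma image_cyc:
  assumes "g \<in> rotations"
  shows "g ` cyc g x = cyc g x"
proof -
  have "g ` cyc g x = {g x, g (g x), g (g (g x))}" by (simp add: cyc_def)
  also have "\<dots> = {g x, g (g x), x}" by (simp only: rotationD(2)[OF assms])
  also have "\<dots> = cyc g x" by (auto simp: cyc_def)
  finally show ?thesis .
qed

lemma cyc_sub:
  assumes "g \<in> rotations" "x \<in> P"
  shows "cyc g x \<subseteq> P"
  using assms(2) by (simp add: cyc_def mem_P[OF rotationD(1)[OF assms(1)]])

text \<open>
  Some point is moved, and its 3-cycle is an invariant triple; by rigidity no point outside it is
  fixed, and no point of a 3-cycle is fixed.
\<close>

lemma rotation_moves:
  assumes g: "g \<in> rotations" and x: "x \<in> P"
  shows "g x \<noteq> x"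
proof
  assume fixed: "g x = x"
  note G = rotationD(1)[OF g]
  have "\<exists>y\<in>P. g y \<noteq> y"
  proof (rule ccontr)
    assume none: "\<not> ?thesis"
    obtain xs where xs: "xs \<in> frames P" by (rule ex_frame)
    then have "set xs \<subseteq> P" by (simp add: frames_def)
    then have "g z = z" if "z \<in> set xs" for z using none that by blast
    then have "map g xs = xs" by (rule map_idI)
    then have "g = id" using frame_fixed[OF G xs] by simp
    then show False using g by (simp add: rotations_def)
  qed
  then obtain y where y: "y \<in> P" "g y \<noteq> y" by blast
  have "x \<notin> cyc g y"
  proof
    assume "x \<in> cyc g y"
    then have "x = y \<or> x = g y \<or> x = g (g y)" by (simp add: cyc_def)
    then show False
    proof (elim disjE)
      assume "x = y"
      then show False using fixed y(2) by simp
    next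
      assume e: "x = g y"
      then have "g x = g y" using fixed by simp
      then show False using inj[OF G] e y(2) by blast
    next
      assume e: "x = g (g y)"
      then have "g (g x) = g (g y)" using fixed by simp
      then have "x = y" using inj[OF G] by blast
      then show False using fixed y(2) by simp
    qed
  qed
  then have "cyc g y \<subseteq> P - {x}" using cyc_sub[OF g y(1)] by blast
  then have "g = id"
    using rigid[OF G x fixed] image_cyc[OF g] card_cyc[OF g y(2)] by blast
  then show False using g by (simp add: rotations_def)
qed

lemma cyc_eq:
  assumes "g \<in> rotations" "x \<in> cyc g y"
  shows "cyc g x = cyc g y"
proof -
  consider "x = y" | "x = g y" | "x = g (g y)" using assms(2) by (auto simp: cyc_def)
  then show ?thesis
    by cases (auto simp: cyc_def rotationD(2)[OF assms(1)])
qed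

lemma parallel_class_partition:
  assumes g: "g \<in> rotations" and x: "x \<in> P"
  shows "\<exists>!A. A \<in> parallel_class g \<and> x \<in> A"
proof (rule ex1I[of _ "cyc g x"])
  show "cyc g x \<in> parallel_class g \<and> x \<in> cyc g x"
    using x by (auto simp: parallel_class_def cyc_def)
next
  fix A assume "A \<in> parallel_class g \<and> x \<in> A"
  then show "A = cyc g x" using cyc_eq[OF g] by (auto simp: parallel_class_def)
qed

lemma parallel_class_triples:
  assumes g: "g \<in> rotations"
  shows "parallel_class g \<subseteq> triples P"
  using card_cyc[OF g rotation_moves[OF g]] cyc_sub[OF g]
  by (auto simp: parallel_class_def triples_def)

text \<open>
  The map that permutes the points of the triple cyclically has a cube that fixes three points.
\<close>

lemma triple_in_parallel_class:
  assumes "T \<in> triples P"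
  shows "\<exists>g\<in>rotations. T \<in> parallel_class g"
proof -
  obtain a b c where T: "T = {a, b, c}" "a \<noteq> b" "b \<noteq> c" "a \<noteq> c" "{a, b, c} \<subseteq> P"
    using assms unfolding triples_def card_3_iff by blast
  have fr: "[a, b, c] \<in> frames P" "[b, c, a] \<in> frames P" using T by (auto simp: frames_def)
  obtain g where g: "g \<in> G" "map g [a, b, c] = [b, c, a]" by (rule ex_map_frame[OF fr])
  have "g \<circ> g \<circ> g = id"
    using g fr(1) by (intro frame_fixed[of _ "[a, b, c]"] comp_in) auto
  moreover have "g \<noteq> id" using g T by auto
  ultimately have "g \<in> rotations" using g by (simp add: rotations_def)
  moreover have "T = cyc g a" using g T by (auto simp: cyc_def)
  ultimately show ?thesis using T by (auto simp: parallel_class_def)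
qed

text \<open>
  Both rotations permute the common triple cyclically. There are only two cyclic permutations of a triple,
  inverse to each other, so sharpness forces \<open>h\<close> to be \<open>g\<close> or \<open>g \<circ> g\<close>, and both have the same cycles.
\<close>

lemma parallel_class_unique:
  assumes g: "g \<in> rotations" and h: "h \<in> rotations"
    and T: "T \<in> parallel_class g" "T \<in> parallel_class h"
  shows "parallel_class g = parallel_class h"
proof -
  obtain x where x: "x \<in> P" "T = cyc g x" using T(1) by (auto simp: parallel_class_def)
  obtain y where y: "y \<in> P" "T = cyc h y" using T(2) by (auto simp: parallel_class_def)
  have "x \<in> T" using x(2) unfolding cyc_def by blast
  then have "x \<in> cyc h y" unfolding y(2) .
  then have "cyc h x = T" using cyc_eq[OF h] y(2) by blast
  then have eq: "cyc h x = cyc g x" using x(2) by (rule trans)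
  note G = rotationD(1)[OF g] rotationD(1)[OF h]
  have moves: "g x \<noteq> x" "h x \<noteq> x" using rotation_moves g h x(1) by blast+
  note gd = moves(1) cyc_distinct[OF g moves(1)] and hd = moves(2) cyc_distinct[OF h moves(2)]
  have fr: "[x, g x, g (g x)] \<in> frames P"
    using gd cyc_sub[OF g x(1)] by (auto simp: frames_def cyc_def)
  have mem: "h x \<in> {x, g x, g (g x)}" "h (h x) \<in> {x, g x, g (g x)}"
    using eq unfolding cyc_def by blast+
  note g3 = rotationD(2)[OF g] and h3 = rotationD(2)[OF h]
  consider "h x = g x" "h (h x) = g (g x)" | "h x = g (g x)" "h (h x) = g x"
    using mem hd by (metis insertE singletonD)
  then show ?thesis
  proof cases
    case 1
    have "h = g"
    proof (rule frame_eqI[OF G(2,1) fr])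
      show "map h [x, g x, g (g x)] = map g [x, g x, g (g x)]"
        using 1 h3[of x] g3[of x] by (simp only: list.map)
    qed
    then show ?thesis by simp
  next
    case 2
    have "h = g \<circ> g"
    proof (rule frame_eqI[OF G(2) comp_in[OF G(1) G(1)] fr])
      show "map h [x, g x, g (g x)] = map (g \<circ> g) [x, g x, g (g x)]"
        using 2 h3[of x] by (simp only: list.map o_apply g3)
    qed
    then have "cyc h z = cyc g z" for z using g3 by (auto simp: cyc_def)
    then show ?thesis by (simp add: parallel_class_def)
  qed
qed

text \<open>
  The number of classes is bounded below because the triples through one fixed point lie in
  different classes.
\<close>

theorem resolution_of_triples:
  obtains n and cl :: "'a set \<Rightarrow> nat"
  where "\<And>A. A \<in> triples P \<Longrightarrow> cl A < n"
    and "\<And>i x. i < n \<Longrightarrow> x \<in> P \<Longrightarrow> \<exists>!A. A \<in> triples P \<and> cl A = i \<and> x \<in> A"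
    and "(card P - 1) choose 2 \<le> n"
proof -
  define \<C> where "\<C> = parallel_class ` rotations"
  have "\<C> \<subseteq> Pow (Pow P)"
    using parallel_class_triples by (auto simp: \<C>_def triples_def)
  then have "finite \<C>" using finite_P by (meson finite_Pow_iff finite_subset)
  then obtain e where "bij_betw e \<C> {0..<card \<C>}" using ex_bij_betw_finite_nat by blast
  then have e_inj: "inj_on e \<C>" and e_im: "e ` \<C> = {0..<card \<C>}" by (auto simp: bij_betw_def)
  \<comment> \<open>Each triple lies in just one class, so \<open>cof\<close> picks the class that contains its argument.\<close>
  define cof where "cof A = (THE c. c \<in> \<C> \<and> A \<in> c)" for A
  have cof: "cof A = c" if "c \<in> \<C>" "A \<in> c" for A c
    unfolding cof_def using that parallel_class_unique by (intro the_equality) (auto simp: \<C>_def)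
  have cof_mem: "cof A \<in> \<C> \<and> A \<in> cof A" if A: "A \<in> triples P" for A
  proof -
    obtain c where "c \<in> \<C>" "A \<in> c" using triple_in_parallel_class[OF A] by (auto simp: \<C>_def)
    then show ?thesis using cof by simp
  qed
  define cl where "cl A = e (cof A)" for A
  have less: "cl A < card \<C>" if "A \<in> triples P" for A
  proof -
    have "e (cof A) \<in> {0..<card \<C>}" using cof_mem[OF that] e_im by blast
    then show ?thesis by (simp add: cl_def)
  qed
  have part: "\<exists>!A. A \<in> triples P \<and> cl A = i \<and> x \<in> A" if i: "i < card \<C>" and x: "x \<in> P" for i x
  proof -
    have "i \<in> e ` \<C>" using i e_im by simp
    then obtain c where c: "c \<in> \<C>" "i = e c" by blast
    then obtain g where g: "g \<in> rotations" "c = parallel_class g" by (auto simp: \<C>_def)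
    have "A \<in> triples P \<and> cl A = i \<longleftrightarrow> A \<in> c" for A
    proof
      assume "A \<in> triples P \<and> cl A = i"
      then have "A \<in> cof A" "cof A = c"
        using cof_mem[of A] c e_inj by (auto simp: cl_def inj_on_def)
      then show "A \<in> c" by simp
    next
      assume "A \<in> c"
      then show "A \<in> triples P \<and> cl A = i"
        using parallel_class_triples[OF g(1)] g(2) cof[OF c(1)] c(2) by (auto simp: cl_def)
    qed
    then show ?thesis using parallel_class_partition[OF g(1) x] g(2) by metis
  qed
  have "(card P - 1) choose 2 \<le> card \<C>"
  proof -
    obtain p where p: "p \<in> P" using card_P by fastforce
    let ?U = "{B. B \<subseteq> P - {p} \<and> card B = 2}"
    have sub: "insert p ` ?U \<subseteq> triples P"
    proof
      fix A assume "A \<in> insert p ` ?U"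
      then obtain B where B: "A = insert p B" "B \<subseteq> P - {p}" "card B = 2" by blast
      then have "finite B" using finite_P finite_subset by blast
      then have "card A = 3" using B by (simp add: card_insert_if subset_Diff_insert)
      then show "A \<in> triples P" using B p by (auto simp: triples_def)
    qed
    have "inj_on (insert p) ?U" by (rule inj_onI) (metis Diff_insert_absorb mem_Collect_eq subset_Diff_insert)
    then have num: "card (insert p ` ?U) = (card P - 1) choose 2"
      using n_subsets[of "P - {p}" 2] finite_P p by (simp add: card_image)
    have "inj_on cl (insert p ` ?U)"
    proof (rule inj_onI)
      fix A B assume AB: "A \<in> insert p ` ?U" "B \<in> insert p ` ?U" "cl A = cl B"
      then have "p \<in> A" "p \<in> B" "A \<in> triples P" "B \<in> triples P" using sub by auto
      then show "A = B" using part[OF less p] AB(3) by metis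
    qed
    moreover have "cl ` insert p ` ?U \<subseteq> {..<card \<C>}" using sub less by blast
    ultimately have "card (insert p ` ?U) \<le> card {..<card \<C>}"
      using card_inj_on_le finite_lessThan by blast
    then show ?thesis using num by simp
  qed
  with less part show thesis by (rule that)
qed

section \<open>Sharply 3-transitive groups: orbits on 6-sets\<close>

text \<open>By 3-transitivity the index of an orbit of 6-sets can be computed at one triple \<open>T0\<close>.\<close>

definition base :: "'a list" where
  "base = (SOME xs. xs \<in> frames P)"

abbreviation T0 :: "'a set" where
  "T0 \<equiv> set base"

lemma base: "base \<in> frames P"
  using ex_frame someI[of "\<lambda>xs. xs \<in> frames P"] unfolding base_def by blast

lemma T0: "T0 \<subseteq> P" "card T0 = 3" "T0 \<in> triples P" "base \<in> frames T0"
  using base distinct_card[of base] by (auto simp: frames_def triples_def)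

lemma finite_G: "finite G"
proof -
  have "inj_on (\<lambda>g. map g base) G" using frame_eqI[OF _ _ base] by (auto simp: inj_on_def)
  moreover have "(\<lambda>g. map g base) ` G \<subseteq> frames P"
    using map_frames[OF _ base] image_P by auto
  ultimately show ?thesis using finite_frames[OF finite_P] inj_on_finite by blast
qed

lemma undo_undo: "g \<in> G \<Longrightarrow> undo (undo g) = g"
  using bij by (rule inv_inv_eq)

definition block_orbit :: "'a set \<Rightarrow> 'a set set" where
  "block_orbit b = (\<lambda>g. g ` b) ` G"

definition setwise_stabilizer :: "'a set \<Rightarrow> ('a \<Rightarrow> 'a) set" where
  "setwise_stabilizer b = {g \<in> G. g ` b = b}"

definition six_sets :: "'a set set" where
  "six_sets = {b. b \<subseteq> P \<and> card b = 6}"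

lemma six_sets_image: "b \<in> six_sets \<Longrightarrow> g \<in> G \<Longrightarrow> g ` b \<in> six_sets"
  using image_P[of g] by (auto simp: six_sets_def card_image_G)

lemma finite_six_sets: "finite six_sets" "b \<in> six_sets \<Longrightarrow> finite b"
  using finite_P by (auto simp: six_sets_def intro: finite_subset)

lemma block_orbitI: "g \<in> G \<Longrightarrow> g ` b \<in> block_orbit b"
  by (simp add: block_orbit_def)

lemma block_orbit_image:
  assumes "c \<in> block_orbit b" "g \<in> G"
  shows "g ` c \<in> block_orbit b"
proof -
  obtain h where "h \<in> G" "c = h ` b" using assms(1) by (auto simp: block_orbit_def)
  then show ?thesis using block_orbitI[OF comp_in[OF assms(2)], of h b] by (simp add: image_comp)
qed

lemma block_orbit_self: "b \<in> block_orbit b"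
  using block_orbitI[OF id_in, of b] by simp

lemma block_orbit_sym:
  assumes "c \<in> block_orbit b"
  shows "b \<in> block_orbit c"
proof -
  obtain g where g: "g \<in> G" "c = g ` b" using assms by (auto simp: block_orbit_def)
  then show ?thesis using block_orbitI[OF undo_in, of g c] by (simp add: undo_image)
qed

lemma block_orbit_subset: "c \<in> block_orbit b \<Longrightarrow> block_orbit c \<subseteq> block_orbit b"
  using block_orbit_image by (auto simp: block_orbit_def[of c])

lemma block_orbit_eq: "c \<in> block_orbit b \<Longrightarrow> block_orbit c = block_orbit b"
  using block_orbit_subset block_orbit_sym by blast

lemma finite_block_orbit: "finite (block_orbit b)"
  by (simp add: block_orbit_def finite_G)

lemma block_orbit_six_sets: "b \<in> six_sets \<Longrightarrow> block_orbit b \<subseteq> six_sets"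
  using six_sets_image by (auto simp: block_orbit_def)

lemma triple_frame:
  assumes "T \<in> triples P"
  obtains xs where "xs \<in> frames P" "set xs = T"
proof -
  have "finite T" "card T = 3" "T \<subseteq> P"
    using assms finite_P by (auto simp: triples_def intro: finite_subset)
  moreover then obtain xs where "set xs = T" "distinct xs" using finite_distinct_list by blast
  ultimately show thesis using that[of xs] distinct_card[of xs] by (simp add: frames_def)
qed

text \<open>A group element that takes \<open>S\<close> to \<open>T\<close> maps the blocks over \<open>S\<close> injectively to blocks over \<open>T\<close>.\<close>

lemma orbit_count_le:
  assumes "S \<in> triples P" "T \<in> triples P"
  shows "card {c \<in> block_orbit b. S \<subseteq> c} \<le> card {c \<in> block_orbit b. T \<subseteq> c}"
proof -
  obtain xs where xs: "xs \<in> frames P" "set xs = S" by (rule triple_frame[OF assms(1)])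
  obtain ys where ys: "ys \<in> frames P" "set ys = T" by (rule triple_frame[OF assms(2)])
  obtain g where g: "g \<in> G" "map g xs = ys" by (rule ex_map_frame[OF xs(1) ys(1)])
  then have "g ` S = T" using xs(2) ys(2) by auto
  then have "(`) g ` {c \<in> block_orbit b. S \<subseteq> c} \<subseteq> {c \<in> block_orbit b. T \<subseteq> c}"
    using block_orbit_image[OF _ g(1)] by blast
  moreover have "inj_on ((`) g) {c \<in> block_orbit b. S \<subseteq> c}"
    using undo_image[OF g(1)] by (intro inj_on_inverseI)
  ultimately show ?thesis
    using finite_block_orbit by (intro card_inj_on_le[of "(`) g"]) auto
qed

lemma orbit_count_eq:
  assumes "T \<in> triples P"
  shows "card {c \<in> block_orbit b. T \<subseteq> c} = card {c \<in> block_orbit b. T0 \<subseteq> c}"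
  using orbit_count_le[OF assms T0(3)] orbit_count_le[OF T0(3) assms] by (rule order_antisym)

definition is_subgroup :: "('a \<Rightarrow> 'a) set \<Rightarrow> bool" where
  "is_subgroup S \<longleftrightarrow> S \<subseteq> G \<and> id \<in> S \<and> (\<forall>g\<in>S. \<forall>h\<in>S. g \<circ> h \<in> S) \<and> (\<forall>g\<in>S. undo g \<in> S)"

definition point_orbit :: "('a \<Rightarrow> 'a) set \<Rightarrow> 'a \<Rightarrow> 'a set" where
  "point_orbit S x = (\<lambda>g. g x) ` S"

lemma subgroup_setwise_stabilizer: "is_subgroup (setwise_stabilizer b)"
  unfolding is_subgroup_def setwise_stabilizer_def
proof (intro conjI ballI)
  fix g h assume "g \<in> {g \<in> G. g ` b = b}" "h \<in> {g \<in> G. g ` b = b}"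
  then show "g \<circ> h \<in> {g \<in> G. g ` b = b}"
    using comp_in image_comp[of g h b] by simp
next
  fix g assume "g \<in> {g \<in> G. g ` b = b}"
  then show "undo g \<in> {g \<in> G. g ` b = b}" using undo_in undo_image[of g b] by simp
qed (use id_in in auto)

lemma point_orbit_eq:
  assumes S: "is_subgroup S" and y: "y \<in> point_orbit S x"
  shows "point_orbit S y = point_orbit S x"
proof -
  obtain g where g: "g \<in> S" "y = g x" using y by (auto simp: point_orbit_def)
  have "g \<in> G" using g(1) S by (auto simp: is_subgroup_def)
  then have x: "x = undo g y" using g(2) undo_apply by simp
  have le: "point_orbit S (h z) \<subseteq> point_orbit S z" if h: "h \<in> S" for h z
  proof
    fix u assume "u \<in> point_orbit S (h z)"
    then obtain k where "k \<in> S" "u = k (h z)" by (auto simp: point_orbit_def)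
    then show "u \<in> point_orbit S z"
      using S h unfolding point_orbit_def is_subgroup_def by (intro image_eqI[of _ _ "k \<circ> h"]) auto
  qed
  have "undo g \<in> S" using g(1) S by (simp add: is_subgroup_def)
  then have "point_orbit S x \<subseteq> point_orbit S y" using le x by metis
  moreover have "point_orbit S y \<subseteq> point_orbit S x" using le g by blast
  ultimately show ?thesis by blast
qed

lemma self_point_orbit: "is_subgroup S \<Longrightarrow> x \<in> point_orbit S x"
  unfolding is_subgroup_def point_orbit_def by (intro image_eqI[of _ _ id]) auto

lemma card_point_orbit:
  assumes S: "is_subgroup S" and free: "\<And>g. g \<in> S \<Longrightarrow> g x = x \<Longrightarrow> g = id"
  shows "card (point_orbit S x) = card S"
proof -
  have "inj_on (\<lambda>g. g x) S"
  proof (rule inj_onI)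
    fix g h assume gh: "g \<in> S" "h \<in> S" "g x = h x"
    have G: "h \<in> G" using gh(2) S by (auto simp: is_subgroup_def)
    have "undo h \<circ> g \<in> S" using gh S by (simp add: is_subgroup_def)
    moreover have "(undo h \<circ> g) x = x" using gh(3) undo_apply[OF G] by simp
    ultimately have e: "undo h \<circ> g = id" by (rule free)
    show "g = h"
    proof
      fix z
      have "undo h (g z) = z" using fun_cong[OF e, of z] by simp
      then have "h (undo h (g z)) = h z" by simp
      then show "g z = h z" by (simp add: apply_undo[OF G])
    qed
  qed
  then show ?thesis unfolding point_orbit_def by (rule card_image)
qed

text \<open>The orbits of a freely acting subgroup are all as large as the subgroup.\<close>

lemma card_semiregular:
  assumes S: "is_subgroup S" and B: "finite B" "\<And>g. g \<in> S \<Longrightarrow> g ` B = B"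
    and free: "\<And>g x. g \<in> S \<Longrightarrow> x \<in> B \<Longrightarrow> g x = x \<Longrightarrow> g = id"
  shows "card B = card S * card (point_orbit S ` B)"
proof (rule card_eq_mult_card_fibres)
  fix Y assume "Y \<in> point_orbit S ` B"
  then obtain x where x: "x \<in> B" "Y = point_orbit S x" by blast
  have "{y \<in> B. point_orbit S y = Y} = point_orbit S x"
  proof (intro equalityI subsetI)
    fix y assume "y \<in> {y \<in> B. point_orbit S y = Y}"
    then show "y \<in> point_orbit S x" using self_point_orbit[OF S, of y] x(2) by simp
  next
    fix y assume y: "y \<in> point_orbit S x"
    then have "y \<in> B" using B(2) x(1) by (auto simp: point_orbit_def)
    then show "y \<in> {y \<in> B. point_orbit S y = Y}" using point_orbit_eq[OF S y] x(2) by simp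
  qed
  then show "card {y \<in> B. point_orbit S y = Y} = card S"
    using card_point_orbit[OF S free[OF _ x(1)]] by simp
qed (use B in auto)

text \<open>An element that fixes a point of \<open>b\<close> preserves the other five points, so rigidity applies.\<close>

lemma card_setwise_stabilizer_dvd:
  assumes b: "b \<in> six_sets"
  shows "card (setwise_stabilizer b) dvd 6"
proof -
  have "g = id" if g: "g \<in> setwise_stabilizer b" and x: "x \<in> b" and fixed: "g x = x" for g x
  proof -
    have G: "g \<in> G" and gb: "g ` b = b" using g by (auto simp: setwise_stabilizer_def)
    have "g ` (b - {x}) = b - {x}"
      using image_set_diff[OF bij_is_inj[OF bij[OF G]], of b "{x}"] gb fixed by simp
    moreover have "card (b - {x}) = 5" using b x by (simp add: six_sets_def)
    ultimately show ?thesis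
      using rigid[OF G, of x "b - {x}"] fixed x b by (auto simp: six_sets_def)
  qed
  moreover have "g ` b = b" if "g \<in> setwise_stabilizer b" for g using that by (simp add: setwise_stabilizer_def)
  ultimately have "card b = card (setwise_stabilizer b) * card (point_orbit (setwise_stabilizer b) ` b)"
    using card_semiregular[OF subgroup_setwise_stabilizer] finite_six_sets(2)[OF b] by blast
  then have "card (setwise_stabilizer b) dvd card b" by (rule dvdI)
  then show ?thesis using b by (simp add: six_sets_def)
qed

text \<open>
  A group element with \<open>T0 \<subseteq> g ` b\<close> is determined by the preimage of the base frame, and every frame
  in \<open>b\<close> occurs as such a preimage.
\<close>

lemma card_covering:
  assumes b: "b \<subseteq> P"
  shows "card {g \<in> G. T0 \<subseteq> g ` b} = card (frames b)"
proof (rule bij_betw_same_card)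
  show "bij_betw (\<lambda>g. map (undo g) base) {g \<in> G. T0 \<subseteq> g ` b} (frames b)"
  proof (rule bij_betw_imageI)
    show "inj_on (\<lambda>g. map (undo g) base) {g \<in> G. T0 \<subseteq> g ` b}"
    proof (rule inj_onI)
      fix g h assume gh: "g \<in> {g \<in> G. T0 \<subseteq> g ` b}" "h \<in> {g \<in> G. T0 \<subseteq> g ` b}"
        and eq: "map (undo g) base = map (undo h) base"
      have G: "g \<in> G" "h \<in> G" using gh by auto
      have "undo g = undo h"
        using frame_eqI[OF undo_in[OF G(1)] undo_in[OF G(2)] base eq] .
      then have "undo (undo g) = undo (undo h)" by (rule arg_cong)
      then show "g = h" by (simp only: undo_undo[OF G(1)] undo_undo[OF G(2)])
    qed
    show "(\<lambda>g. map (undo g) base) ` {g \<in> G. T0 \<subseteq> g ` b} = frames b"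
    proof (intro equalityI subsetI)
      fix xs assume "xs \<in> (\<lambda>g. map (undo g) base) ` {g \<in> G. T0 \<subseteq> g ` b}"
      then obtain g where g: "g \<in> G" "T0 \<subseteq> g ` b" "xs = map (undo g) base" by blast
      have "undo g ` T0 \<subseteq> undo g ` (g ` b)" using g(2) by (rule image_mono)
      then have "undo g ` T0 \<subseteq> b" using undo_image[OF g(1)] by simp
      then show "xs \<in> frames b"
        using frames_mono[OF _ map_frames[OF undo_in[OF g(1)] T0(4)]] g(3) by simp
    next
      fix xs assume xs: "xs \<in> frames b"
      then have xsP: "xs \<in> frames P" using frames_mono[OF b] by blast
      obtain g where g: "g \<in> G" "map g xs = base" by (rule ex_map_frame[OF xsP base])
      have "T0 = g ` set xs" using arg_cong[OF g(2), of set] by simp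
      then have "T0 \<subseteq> g ` b" using xs by (auto simp: frames_def)
      moreover have "map (undo g) base = xs"
        unfolding g(2)[symmetric] by (simp add: undo_apply[OF g(1)] map_idI)
      ultimately show "xs \<in> (\<lambda>g. map (undo g) base) ` {g \<in> G. T0 \<subseteq> g ` b}"
        using g(1) by (intro image_eqI[of _ _ g]) auto
    qed
  qed
qed

lemma card_setwise_stabilizer_T0: "card (setwise_stabilizer T0) = 6"
proof -
  have "T0 \<subseteq> g ` T0 \<longleftrightarrow> g ` T0 = T0" if "g \<in> G" for g
    using card_image_G[OF that, of T0] card_subset_eq[of "g ` T0" T0] by auto
  then have "{g \<in> G. T0 \<subseteq> g ` T0} = setwise_stabilizer T0"
    unfolding setwise_stabilizer_def by blast
  then show ?thesis using card_covering[OF T0(1)] card_frames[of T0] T0(2) by simp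
qed

text \<open>
  The \<open>6 * 5 * 4\<close> group elements that move \<open>b\<close> over \<open>T0\<close> are grouped by the image of \<open>b\<close>; the
  elements with the same image form a coset of the stabilizer.
\<close>

lemma setwise_stabilizer_times_count:
  assumes b: "b \<in> six_sets"
  shows "card (setwise_stabilizer b) * card {c \<in> block_orbit b. T0 \<subseteq> c} = 120"
proof -
  have "card {g \<in> G. T0 \<subseteq> g ` b} = card (setwise_stabilizer b) * card {c \<in> block_orbit b. T0 \<subseteq> c}"
  proof (rule card_eq_mult_card_fibres[where f = "\<lambda>g. g ` b"])
    fix c assume "c \<in> {c \<in> block_orbit b. T0 \<subseteq> c}"
    then obtain g where g: "g \<in> G" "c = g ` b" "T0 \<subseteq> c" by (auto simp: block_orbit_def)
    have "{h \<in> {g \<in> G. T0 \<subseteq> g ` b}. h ` b = c} = (\<lambda>s. g \<circ> s) ` setwise_stabilizer b"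
    proof (intro equalityI subsetI)
      fix h assume "h \<in> {h \<in> {g \<in> G. T0 \<subseteq> g ` b}. h ` b = c}"
      then have h: "h \<in> G" "h ` b = c" by auto
      have "(undo g \<circ> h) ` b = undo g ` (h ` b)" by (rule image_comp[symmetric])
      also have "\<dots> = b" unfolding h(2) g(2) by (rule undo_image[OF g(1)])
      finally have "undo g \<circ> h \<in> setwise_stabilizer b"
        using comp_in[OF undo_in[OF g(1)] h(1)] by (simp add: setwise_stabilizer_def)
      moreover have "h = g \<circ> (undo g \<circ> h)" by (rule ext) (simp add: apply_undo[OF g(1)])
      ultimately show "h \<in> (\<lambda>s. g \<circ> s) ` setwise_stabilizer b"
        using image_eqI[of h "(\<circ>) g" "undo g \<circ> h" "setwise_stabilizer b"] by blast
    next
      fix h assume "h \<in> (\<lambda>s. g \<circ> s) ` setwise_stabilizer b"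
      then obtain s where s: "s \<in> G" "s ` b = b" "h = g \<circ> s" by (auto simp: setwise_stabilizer_def)
      have "h ` b = g ` (s ` b)" unfolding s(3) by (rule image_comp[symmetric])
      then have "h ` b = c" using s(2) g(2) by simp
      then show "h \<in> {h \<in> {g \<in> G. T0 \<subseteq> g ` b}. h ` b = c}"
        using g s comp_in by simp
    qed
    moreover have "inj_on (\<lambda>s. g \<circ> s) (setwise_stabilizer b)"
    proof (rule inj_onI)
      fix s t assume "g \<circ> s = g \<circ> t"
      then have "g (s z) = g (t z)" for z by (metis comp_apply)
      then show "s = t" using inj[OF g(1)] by blast
    qed
    ultimately show "card {h \<in> {g \<in> G. T0 \<subseteq> g ` b}. h ` b = c} = card (setwise_stabilizer b)"
      by (simp only: card_image)
  qed (use finite_G finite_block_orbit in \<open>auto simp: block_orbit_def\<close>)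
  moreover have "card {g \<in> G. T0 \<subseteq> g ` b} = 120"
    using card_covering[of b] card_frames[of b] b finite_six_sets(2)[OF b] by (simp add: six_sets_def)
  ultimately show ?thesis by simp
qed

text \<open>The index of an orbit of 6-sets as a 3-design, in units of 20.\<close>

definition weight :: "'a set set \<Rightarrow> nat" where
  "weight \<O> = card {c \<in> \<O>. T0 \<subseteq> c} div 20"

lemma weight:
  assumes b: "b \<in> six_sets"
  shows "card {c \<in> block_orbit b. T0 \<subseteq> c} = 20 * weight (block_orbit b)"
    and "weight (block_orbit b) \<le> 6"
proof -
  obtain k where k: "6 = card (setwise_stabilizer b) * k" using card_setwise_stabilizer_dvd[OF b] by blast
  have pos: "card (setwise_stabilizer b) > 0" using k by (cases "card (setwise_stabilizer b)") auto
  have "card (setwise_stabilizer b) * card {c \<in> block_orbit b. T0 \<subseteq> c} = card (setwise_stabilizer b) * (20 * k)"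
    unfolding setwise_stabilizer_times_count[OF b] mult.left_commute[of _ 20] k[symmetric] by simp
  then have c: "card {c \<in> block_orbit b. T0 \<subseteq> c} = 20 * k" using pos by simp
  then show "card {c \<in> block_orbit b. T0 \<subseteq> c} = 20 * weight (block_orbit b)"
    by (simp add: weight_def)
  have "k dvd 6" using k by (metis dvd_triv_right)
  then have "k \<le> 6" by (simp add: dvd_imp_le)
  then show "weight (block_orbit b) \<le> 6" using c by (simp add: weight_def)
qed

lemma setwise_stabilizer_T0_free:
  assumes g: "g \<in> setwise_stabilizer T0" and x: "x \<in> P - T0" and fixed: "g x = x"
  shows "g = id"
proof -
  have "g \<in> G" "g ` T0 = T0" using g by (auto simp: setwise_stabilizer_def)
  then show ?thesis using rigid[of g x T0] x fixed T0 by auto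
qed

lemma setwise_stabilizer_T0_outside: "g \<in> setwise_stabilizer T0 \<Longrightarrow> g ` (P - T0) = P - T0"
  using image_set_diff[OF bij_is_inj[OF bij], of g P T0] image_P by (simp add: setwise_stabilizer_def)

text \<open>
  The regular orbits of the stabilizer of \<open>T0\<close>, which is a group of order 6. On the projective line
  with \<open>T0\<close> consisting of infinity, 0 and 1 they are the sets of the six cross-ratios of four points.
\<close>

definition hexads :: "'a set set" where
  "hexads = point_orbit (setwise_stabilizer T0) ` (P - T0)"

lemma card_P_hexads: "card P = 6 * card hexads + 3"
proof -
  have "card (P - T0) = 6 * card hexads"
    unfolding hexads_def using card_semiregular[OF subgroup_setwise_stabilizer, of "P - T0" T0]
      setwise_stabilizer_T0_outside setwise_stabilizer_T0_free finite_P card_setwise_stabilizer_T0 by simp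
  moreover have "card (P - T0) = card P - 3" using T0 by (simp add: card_Diff_subset)
  ultimately show ?thesis using card_P by simp
qed

lemma card_point_orbit_T0: "x \<in> P - T0 \<Longrightarrow> card (point_orbit (setwise_stabilizer T0) x) = 6"
  using card_point_orbit[OF subgroup_setwise_stabilizer] setwise_stabilizer_T0_free card_setwise_stabilizer_T0 by simp

lemma hexad_six_set:
  assumes "b \<in> hexads"
  shows "b \<in> six_sets"
proof -
  obtain x where x: "x \<in> P - T0" "b = point_orbit (setwise_stabilizer T0) x" using assms by (auto simp: hexads_def)
  then have "b \<subseteq> P" using mem_P by (auto simp: point_orbit_def setwise_stabilizer_def)
  then show ?thesis using card_point_orbit_T0 x by (simp add: six_sets_def)
qed

lemma point_orbit_image:
  assumes "is_subgroup S" "g \<in> S"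
  shows "g ` point_orbit S x = point_orbit S x"
proof -
  have "h ` point_orbit S x \<subseteq> point_orbit S x" if h: "h \<in> S" for h
  proof
    fix y assume "y \<in> h ` point_orbit S x"
    then obtain k where "k \<in> S" "y = h (k x)" by (auto simp: point_orbit_def)
    then show "y \<in> point_orbit S x"
      using assms(1) h unfolding point_orbit_def is_subgroup_def by (intro image_eqI[of _ _ "h \<circ> k"]) auto
  qed
  moreover have "undo g \<in> S" "g \<in> G" using assms by (auto simp: is_subgroup_def)
  ultimately have "undo g ` point_orbit S x \<subseteq> point_orbit S x" "g ` point_orbit S x \<subseteq> point_orbit S x"
    using assms(2) by blast+
  moreover have "g ` (undo g ` point_orbit S x) = point_orbit S x" using image_undo[OF \<open>g \<in> G\<close>] .
  ultimately show ?thesis by (metis image_mono subset_antisym)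
qed

text \<open>The stabilizer of a hexad contains that of \<open>T0\<close>, and it has at most 6 elements.\<close>

lemma setwise_stabilizer_hexad:
  assumes "b \<in> hexads"
  shows "setwise_stabilizer b = setwise_stabilizer T0"
proof -
  obtain x where x: "b = point_orbit (setwise_stabilizer T0) x" using assms by (auto simp: hexads_def)
  have sub: "setwise_stabilizer T0 \<subseteq> setwise_stabilizer b"
  proof
    fix g assume g: "g \<in> setwise_stabilizer T0"
    then have "g ` b = b" unfolding x by (rule point_orbit_image[OF subgroup_setwise_stabilizer])
    then show "g \<in> setwise_stabilizer b" using g by (simp add: setwise_stabilizer_def)
  qed
  have "finite (setwise_stabilizer b)" using finite_G by (simp add: setwise_stabilizer_def)
  moreover have "card (setwise_stabilizer b) \<le> 6" using card_setwise_stabilizer_dvd[OF hexad_six_set[OF assms]] by (simp add: dvd_imp_le)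
  ultimately show ?thesis
    using card_seteq[OF _ sub] card_setwise_stabilizer_T0 by simp
qed

lemma hexad_weight:
  assumes "b \<in> hexads"
  shows "weight (block_orbit b) = 1"
  using setwise_stabilizer_times_count[OF hexad_six_set[OF assms]] setwise_stabilizer_hexad[OF assms] card_setwise_stabilizer_T0
  by (simp add: weight_def)

text \<open>
  If \<open>g\<close> takes one hexad to another, it normalizes their common stabilizer, which is that of \<open>T0\<close>.
  Then \<open>g ` T0\<close> is invariant under this stabilizer. Outside \<open>T0\<close> its orbits have 6 points, so
  \<open>g ` T0 = T0\<close>, and \<open>g\<close> preserves every hexad.
\<close>

lemma hexad_orbits_inj: "inj_on block_orbit hexads"
proof (rule inj_onI)
  fix b c assume b: "b \<in> hexads" and c: "c \<in> hexads" and "block_orbit b = block_orbit c"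
  then have "c \<in> block_orbit b" using block_orbit_self by simp
  then obtain g where g: "g \<in> G" "c = g ` b" by (auto simp: block_orbit_def)
  have inv: "h ` (g ` T0) = g ` T0" if h: "h \<in> setwise_stabilizer T0" for h
  proof -
    have "h \<in> setwise_stabilizer c" using h setwise_stabilizer_hexad[OF c] by simp
    then have hc: "h \<in> G" "h ` c = c" unfolding setwise_stabilizer_def by blast+
    have im: "(undo g \<circ> (h \<circ> g)) ` A = undo g ` (h ` (g ` A))" for A by (simp only: image_comp)
    have "(undo g \<circ> (h \<circ> g)) ` b = undo g ` (h ` (g ` b))" by (rule im)
    also have "\<dots> = b" using hc(2) undo_image[OF g(1), of b] unfolding g(2) by (simp only:)
    finally have "undo g \<circ> (h \<circ> g) \<in> setwise_stabilizer b"
      using hc g comp_in undo_in by (simp add: setwise_stabilizer_def)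
    then have "undo g \<circ> (h \<circ> g) \<in> setwise_stabilizer T0" using setwise_stabilizer_hexad[OF b] by simp
    then have "(undo g \<circ> (h \<circ> g)) ` T0 = T0" unfolding setwise_stabilizer_def by blast
    then have "undo g ` (h ` (g ` T0)) = T0" unfolding im .
    then have "g ` (undo g ` (h ` (g ` T0))) = g ` T0" by (rule arg_cong)
    then show ?thesis unfolding image_undo[OF g(1)] .
  qed
  have "g ` T0 \<subseteq> T0"
  proof (rule ccontr)
    assume "\<not> g ` T0 \<subseteq> T0"
    then obtain p where p: "p \<in> g ` T0" "p \<notin> T0" by blast
    then have "p \<in> P - T0" using T0(1) image_P[OF g(1)] by blast
    moreover have "point_orbit (setwise_stabilizer T0) p \<subseteq> g ` T0"
    proof
      fix y assume "y \<in> point_orbit (setwise_stabilizer T0) p"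
      then obtain h where h: "h \<in> setwise_stabilizer T0" "y = h p" by (auto simp: point_orbit_def)
      then have "y \<in> h ` (g ` T0)" using p(1) by blast
      then show "y \<in> g ` T0" unfolding inv[OF h(1)] .
    qed
    then have "card (point_orbit (setwise_stabilizer T0) p) \<le> card (g ` T0)" by (intro card_mono) auto
    ultimately show False using card_point_orbit_T0 card_image_G[OF g(1)] T0(2) by simp
  qed
  then have "g ` T0 = T0"
    using card_image_G[OF g(1)] by (intro card_subset_eq) auto
  then have "g \<in> setwise_stabilizer T0" using g(1) by (simp add: setwise_stabilizer_def)
  then have "g \<in> setwise_stabilizer b" using setwise_stabilizer_hexad[OF b] by simp
  then show "b = c" using g(2) by (simp add: setwise_stabilizer_def)
qed

lemma card_six_sets_over_T0: "card {b \<in> six_sets. T0 \<subseteq> b} = (card P - 3) choose 3"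
proof -
  let ?U = "{B. B \<subseteq> P - T0 \<and> card B = 3}"
  have "{b \<in> six_sets. T0 \<subseteq> b} = (\<lambda>B. T0 \<union> B) ` ?U"
  proof (intro equalityI subsetI)
    fix b assume b: "b \<in> {b \<in> six_sets. T0 \<subseteq> b}"
    then have "card (b - T0) = 3" using T0(2) by (simp add: card_Diff_subset six_sets_def)
    then show "b \<in> (\<lambda>B. T0 \<union> B) ` ?U"
      using b by (intro image_eqI[of _ _ "b - T0"]) (auto simp: six_sets_def)
  next
    fix b assume "b \<in> (\<lambda>B. T0 \<union> B) ` ?U"
    then obtain B where B: "b = T0 \<union> B" "B \<subseteq> P - T0" "card B = 3" by blast
    have "finite B" "T0 \<inter> B = {}" using B finite_P finite_subset by blast+
    then have "card b = 6" using B T0(2) by (simp add: card_Un_disjoint)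
    then show "b \<in> {b \<in> six_sets. T0 \<subseteq> b}" using B T0(1) by (auto simp: six_sets_def)
  qed
  moreover have "inj_on (\<lambda>B. T0 \<union> B) ?U" by (rule inj_onI) blast
  ultimately have "card {b \<in> six_sets. T0 \<subseteq> b} = card ?U" by (simp only: card_image)
  also have "\<dots> = card (P - T0) choose 3" using finite_P by (intro n_subsets) simp
  finally show ?thesis using T0 by (simp add: card_Diff_subset)
qed

text \<open>
  The weights of all orbits add up to the number of 6-sets over \<open>T0\<close>, divided by 20. Since no weight
  exceeds 6, a greedy choice of orbits misses \<open>M\<close> by at most 5, and five orbits of hexads
  close the gap.
\<close>

theorem six_set_designs:
  assumes M: "20 * (M + 5) \<le> (card P - 3) choose 3"
  obtains D where "D \<subseteq> six_sets" "\<And>T. T \<in> triples P \<Longrightarrow> card {b \<in> D. T \<subseteq> b} = 20 * M"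
proof -
  define \<Omega> where "\<Omega> = block_orbit ` six_sets"
  have fin: "finite \<Omega>" using finite_six_sets by (simp add: \<Omega>_def)
  have orbit_sum: "card {b \<in> \<Union>\<Sigma>. T \<subseteq> b} = 20 * sum weight \<Sigma>"
    if \<Sigma>: "\<Sigma> \<subseteq> \<Omega>" and T: "T \<in> triples P" for \<Sigma> T
  proof -
    have orb: "block_orbit b = \<O>" if "b \<in> \<O>" "\<O> \<in> \<Sigma>" for b \<O>
      using that \<Sigma> block_orbit_eq by (auto simp: \<Omega>_def)
    have finU: "finite (\<Union>\<Sigma>)"
      using \<Sigma> fin finite_block_orbit finite_subset by (intro finite_Union) (auto simp: \<Omega>_def)
    have fin_cover: "finite {b \<in> \<Union>\<Sigma>. T \<subseteq> b}" by (rule finite_subset[OF _ finU]) blast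
    have "card {b \<in> \<Union>\<Sigma>. T \<subseteq> b}
        = (\<Sum>\<O>\<in>\<Sigma>. card {b \<in> {b \<in> \<Union>\<Sigma>. T \<subseteq> b}. block_orbit b = \<O>})"
      using orb by (intro card_eq_sum_card_fibres[OF fin_cover finite_subset[OF \<Sigma> fin]]) auto
    also have "\<dots> = (\<Sum>\<O>\<in>\<Sigma>. 20 * weight \<O>)"
    proof (rule sum.cong)
      fix \<O> assume O: "\<O> \<in> \<Sigma>"
      then obtain b where b: "b \<in> six_sets" "\<O> = block_orbit b" using \<Sigma> by (auto simp: \<Omega>_def)
      have "{b \<in> {b \<in> \<Union>\<Sigma>. T \<subseteq> b}. block_orbit b = \<O>} = {b \<in> \<O>. T \<subseteq> b}"
        using O orb block_orbit_self by blast
      then show "card {b \<in> {b \<in> \<Union>\<Sigma>. T \<subseteq> b}. block_orbit b = \<O>} = 20 * weight \<O>"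
        using orbit_count_eq[OF T, of b] weight(1)[OF b(1)] b(2) by simp
    qed simp
    finally show ?thesis by (simp add: sum_distrib_left)
  qed
  have "\<Union>\<Omega> = six_sets"
    using block_orbit_six_sets block_orbit_self by (auto simp: \<Omega>_def)
  then have "20 * sum weight \<Omega> = (card P - 3) choose 3"
    using orbit_sum[OF order_refl T0(3)] card_six_sets_over_T0 by simp
  then have total: "M + 5 \<le> sum weight \<Omega>" using M by simp
  have "card (block_orbit ` hexads) \<ge> 5"
    using card_P card_P_hexads by (simp add: card_image[OF hexad_orbits_inj])
  then obtain U where U: "U \<subseteq> block_orbit ` hexads" "card U = 5"
    by (rule obtain_subset_with_card_n)
  have "U \<subseteq> \<Omega>" using U(1) hexad_six_set by (auto simp: \<Omega>_def)
  moreover have "weight \<O> = 1" if "\<O> \<in> U" for \<O> using that U(1) hexad_weight by blast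
  moreover have "weight \<O> \<le> Suc 5" if "\<O> \<in> \<Omega>" for \<O>
    using that weight(2) by (auto simp: \<Omega>_def)
  ultimately obtain \<Sigma> where \<Sigma>: "\<Sigma> \<subseteq> \<Omega>" "sum weight \<Sigma> = M"
    using subset_sum_with_units[OF fin _ _ U(2) _ total] by blast
  have "\<Union>\<Sigma> \<subseteq> six_sets" using \<Sigma>(1) \<open>\<Union>\<Omega> = six_sets\<close> by blast
  then show thesis using that[of "\<Union>\<Sigma>"] orbit_sum[OF \<Sigma>(1)] \<Sigma>(2) by blast
qed

text \<open>
  With \<open>card P = 6 * N + 3\<close>, the index of the 6-sets that balances \<open>m = 5 * k\<close> mixed classes is
  \<open>20 * (k * N)\<close>. The bound on \<open>k\<close> keeps this index below the total index of all 6-sets, and \<open>m\<close> below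
  the number of parallel classes.
\<close>

theorem doubled_orbit_design:
  assumes k: "k \<le> 16"
  shows "\<exists>(X :: nat set) B.
    is_design 3 (2 * card P) 6 ((card P - 2) * (5 * k)) X B \<and> simple_blocks B"
proof -
  define N where "N = card hexads"
  have v: "card P = 6 * N + 3" using card_P_hexads by (simp add: N_def)
  have N: "5 \<le> N" using v card_P by simp
  obtain n and cl :: "'a set \<Rightarrow> nat" where cl:
    "\<And>A. A \<in> triples P \<Longrightarrow> cl A < n"
    "\<And>i x. i < n \<Longrightarrow> x \<in> P \<Longrightarrow> \<exists>!A. A \<in> triples P \<and> cl A = i \<and> x \<in> A"
    and n: "(card P - 1) choose 2 \<le> n"
    by (rule resolution_of_triples) blast
  have "32 * 31 \<le> (card P - 1) * (card P - 1 - 1)"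
    using card_P by (intro mult_le_mono) auto
  then have "32 * 31 div 2 \<le> (card P - 1) choose 2"
    unfolding choose_two by (rule div_le_mono)
  then have m: "5 * k \<le> n" using n k by simp
  have "20 * (k * N + 5) \<le> (card P - 3) choose 3"
  proof -
    have "k * N \<le> 16 * N" using k by (rule mult_le_mono1)
    then have "k * N + 5 \<le> 16 * N + N" using N by (rule add_mono)
    then have "k * N + 5 \<le> 17 * N" by simp
    then have "20 * (k * N + 5) * 6 \<le> 20 * (17 * N) * 6"
      by (intro mult_le_mono1 mult_le_mono2)
    also have "\<dots> \<le> 6 * N * 812" by simp
    also have "\<dots> \<le> 6 * N * ((6 * N - 1) * (6 * N - 2))"
    proof (rule mult_le_mono2)
      have "29 * 28 \<le> (6 * N - 1) * (6 * N - 2)" using N by (intro mult_le_mono) auto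
      then show "812 \<le> (6 * N - 1) * (6 * N - 2)" by simp
    qed
    also have "\<dots> = 6 * ((6 * N) choose 3)"
    proof -
      have "fact 3 * (fact (6 * N - 3) * ((6 * N) choose 3)) = (fact (6 * N) :: nat)"
        using binomial_fact_lemma[of 3 "6 * N"] N by (simp only: mult.assoc)
      moreover have "(fact (6 * N) :: nat) = 6 * N * ((6 * N - 1) * ((6 * N - 2) * fact (6 * N - 3)))"
        using N by (simp add: fact_reduce numeral_eq_Suc)
      ultimately have "fact (6 * N - 3) * (6 * ((6 * N) choose 3))
          = (fact (6 * N - 3) :: nat) * (6 * N * ((6 * N - 1) * (6 * N - 2)))"
        by (simp add: fact_numeral mult_ac)
      then show ?thesis by simp
    qed
    finally show ?thesis unfolding v by simp
  qed
  then obtain D where D: "D \<subseteq> six_sets"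
    "\<And>T. T \<in> triples P \<Longrightarrow> card {b \<in> D. T \<subseteq> b} = 20 * (k * N)"
    by (rule six_set_designs) blast
  have "3 * (20 * (k * N)) + 5 * k * card P = 3 * (5 * k * (card P - 2))"
    unfolding v by (simp add: algebra_simps)
  with D show ?thesis
    by (intro doubled_design[OF finite_P refl cl m, of D]) (auto simp: six_sets_def)
qed

end

section \<open>The projective line over a finite field of characteristic two\<close>

lemma power_eq_1_coprime:
  fixes x :: "'k::field"
  assumes "x ^ m = 1" "x ^ n = 1" "coprime m n"
  shows "x = 1"
proof (cases "n = 1")
  case False
  then obtain a b where "m * a = n * b + 1"
    using coprime_bezout_strong[OF assms(3)] by blast
  then have "(x ^ m) ^ a = (x ^ n) ^ b * x"
    by (simp add: power_mult[symmetric])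
  then show ?thesis using assms(1,2) by simp
qed (use assms in simp)

text \<open>
  In an algebraically closed field of characteristic two, this is the subfield with \<open>q\<close> elements
  if \<open>q\<close> is a power of 2 greater than 1.
\<close>

definition frobenius_field :: "nat \<Rightarrow> 'k::field set" where
  "frobenius_field q = {x. x ^ q = x}"

lemma power_two_power_add:
  fixes x y :: "'k::field"
  assumes two: "(2 :: 'k) = 0"
  shows "(x + y) ^ 2 ^ n = x ^ 2 ^ n + y ^ 2 ^ n"
proof (induction n)
  case (Suc n)
  have "(x + y) ^ 2 ^ Suc n = (x ^ 2 ^ n + y ^ 2 ^ n)\<^sup>2"
    by (simp add: power_mult mult.commute[of 2] Suc.IH)
  also have "\<dots> = (x ^ 2 ^ n)\<^sup>2 + (y ^ 2 ^ n)\<^sup>2"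
    by (simp add: power2_sum two)
  finally show ?case by (simp add: power_mult mult.commute[of 2])
qed simp

text \<open>The polynomial \<open>x ^ q - x\<close> has derivative \<open>- 1\<close>, so its \<open>q\<close> roots are distinct.\<close>

lemma card_frobenius_field:
  assumes two: "(2 :: 'k::alg_closed_field) = 0" and f: "f > 0"
  shows "card (frobenius_field (2 ^ f) :: 'k set) = 2 ^ f"
proof -
  define q :: nat where "q = 2 ^ f"
  define p :: "'k poly" where "p = monom 1 q - monom 1 1"
  have q1: "q > 1" unfolding q_def using one_less_power[of "2 :: nat" f] f by simp
  have deg: "degree p = q"
    unfolding p_def using q1 degree_add_eq_left[of "- monom 1 1" "monom (1::'k) q"]
    by (simp add: degree_monom_eq)
  then have p0: "p \<noteq> 0" using q1 by auto
  have "of_nat q = (0 :: 'k)" using f two by (simp add: q_def)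
  then have deriv: "pderiv p = - 1" by (simp add: p_def pderiv_diff pderiv_monom monom_0 one_pCons)
  obtain A where A: "size A = degree p" "p = smult (lead_coeff p) (\<Prod>x\<in>#A. [:-x, 1:])"
    using alg_closed_imp_factorization[OF p0] by blast
  have "count A a \<le> 1" for a
  proof (rule ccontr)
    assume "\<not> count A a \<le> 1"
    then have "{#a, a#} \<subseteq># A"
      by (simp add: insert_subset_eq_iff count_greater_zero_iff[symmetric] del: count_greater_zero_iff)
    then obtain B where "A = {#a, a#} + B" by (metis subset_mset.le_iff_add)
    then have "p = [:-a, 1:] * ([:-a, 1:] * smult (lead_coeff p) (\<Prod>x\<in>#B. [:-x, 1:]))"
      using A(2) by simp
    then obtain r where r: "p = [:-a, 1:] * ([:-a, 1:] * r)" by blast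
    have root: "poly [:-a, 1:] a = 0" by simp
    have "poly (pderiv p) a = 0"
      unfolding r by (simp only: pderiv_mult poly_add poly_mult root mult_zero_left add_0)
    then show False using deriv by simp
  qed
  then have "A = mset_set (set_mset A)"
    by (intro multiset_eqI) (metis count_mset_set(1) count_mset_set(3) finite_set_mset le_antisym
        count_greater_eq_one_iff not_in_iff)
  then have "size A = card (set_mset A)" by (metis size_mset_set)
  moreover have "frobenius_field q = set_mset A"
  proof -
    have "poly p x = lead_coeff p * (\<Prod>a\<in>#A. x - a)" for x
      by (subst A(2)) (simp add: poly_prod_mset image_mset.compositionality o_def)
    moreover have "poly p x = x ^ q - x" for x by (simp add: p_def poly_monom)
    moreover have "(\<Prod>a\<in>#A. x - a) = 0 \<longleftrightarrow> x \<in># A" for x by auto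
    ultimately have "x ^ q - x = 0 \<longleftrightarrow> x \<in># A" for x
      using p0 by (metis leading_coeff_0_iff mult_eq_0_iff)
    then show ?thesis by (auto simp: frobenius_field_def)
  qed
  ultimately show ?thesis using A(1) deg by (simp add: q_def)
qed

lemma frobenius_field_closed:
  fixes x y :: "'k::field" and f :: nat
  assumes two: "(2 :: 'k) = 0"
  defines "K \<equiv> frobenius_field (2 ^ f) :: 'k set"
  shows "0 \<in> K" "1 \<in> K" "x \<in> K \<Longrightarrow> y \<in> K \<Longrightarrow> x + y \<in> K"
    "x \<in> K \<Longrightarrow> y \<in> K \<Longrightarrow> x * y \<in> K" "x \<in> K \<Longrightarrow> y \<in> K \<Longrightarrow> x / y \<in> K"
  using power_two_power_add[OF two, of x y f]
  by (simp_all add: K_def frobenius_field_def power_mult_distrib power_divide)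

text \<open>An odd power of 2 is 2 modulo 3, and 2 or 3 modulo 5.\<close>

lemma coprime_two_power_minus_1:
  assumes "odd f"
  shows "coprime 2 (2 ^ f - 1 :: nat)" "coprime 3 (2 ^ f - 1 :: nat)"
    "coprime 4 (2 ^ f - 1 :: nat)" "coprime 5 (2 ^ f - 1 :: nat)"
proof -
  obtain j where j: "f = 2 * j + 1" using assms by (rule oddE)
  define r :: nat where "r = 2 ^ f - 1"
  have "(2 :: nat) ^ f = 2 * 4 ^ j" by (simp add: j power_add power_mult)
  then have e: "r + 1 = 2 * 4 ^ j" by (simp add: r_def)
  have "(4 :: nat) ^ j mod 3 = 1"
  proof (induction j)
    case (Suc j)
    have "(4 :: nat) ^ Suc j mod 3 = 4 * (4 ^ j mod 3) mod 3" by (simp add: mod_simps)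
    then show ?case using Suc by simp
  qed simp
  then have "(r + 1) mod 3 = 2" unfolding e by (simp add: mod_mult_right_eq[of 2 "4 ^ j", symmetric])
  then have "\<not> 3 dvd r" by (auto elim!: dvdE)
  moreover have "(4 :: nat) ^ j mod 5 = 1 \<or> (4 :: nat) ^ j mod 5 = 4"
  proof (induction j)
    case (Suc j)
    have "(4 :: nat) ^ Suc j mod 5 = 4 * (4 ^ j mod 5) mod 5" by (simp add: mod_simps)
    then show ?case using Suc by auto
  qed simp
  then have "(r + 1) mod 5 = 2 \<or> (r + 1) mod 5 = 3"
    unfolding e by (auto simp: mod_mult_right_eq[of 2 "4 ^ j", symmetric])
  then have "\<not> 5 dvd r" by (auto elim!: dvdE)
  moreover have "\<not> 2 dvd r" using arg_cong[OF e, of even] by simp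
  ultimately have cop: "coprime 2 r" "coprime 3 r" "coprime 5 r"
    by (simp_all add: prime_imp_coprime)
  then have "coprime (2 ^ 2) r" by (simp only: coprime_power_left_iff simp_thms)
  then have "coprime 4 r" by simp
  then show "coprime 2 (2 ^ f - 1 :: nat)" "coprime 3 (2 ^ f - 1 :: nat)"
    "coprime 4 (2 ^ f - 1 :: nat)" "coprime 5 (2 ^ f - 1 :: nat)"
    using cop by (simp_all only: r_def)
qed

text \<open>
  The point with homogeneous coordinates \<open>u\<close> and \<open>v\<close>, where \<open>None\<close> is the point at infinity. It is
  meaningful only if \<open>u\<close> and \<open>v\<close> are not both 0.
\<close>

definition ratio :: "'k::field \<Rightarrow> 'k \<Rightarrow> 'k option" where
  "ratio u v = (if v = 0 then None else Some (u / v))"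

definition moebius :: "'k::field \<Rightarrow> 'k \<Rightarrow> 'k \<Rightarrow> 'k \<Rightarrow> 'k option \<Rightarrow> 'k option" where
  "moebius a b c d p = (case p of None \<Rightarrow> ratio a c | Some x \<Rightarrow> ratio (a * x + b) (c * x + d))"

lemma ratio_scale: "k \<noteq> 0 \<Longrightarrow> ratio (k * u) (k * v) = ratio u v"
  by (simp add: ratio_def)

lemma moebius_simps:
  "moebius a b c d None = ratio a c" "moebius a b c d (Some x) = ratio (a * x + b) (c * x + d)"
  by (simp_all add: moebius_def)

text \<open>In homogeneous coordinates a fractional linear map is linear, without exceptions at infinity.\<close>

lemma moebius_ratio:
  assumes "u \<noteq> 0 \<or> v \<noteq> 0"
  shows "moebius a b c d (ratio u v) = ratio (a * u + b * v) (c * u + d * v)"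
proof (cases "v = 0")
  case True
  then have "ratio (u * a) (u * c) = ratio a c" using assms by (intro ratio_scale) simp
  then show ?thesis using True by (simp add: ratio_def[of u 0] moebius_simps mult.commute)
next
  case False
  have "moebius a b c d (ratio u v) = ratio (v * (a * (u / v) + b)) (v * (c * (u / v) + d))"
    unfolding ratio_scale[OF False] using False by (simp add: moebius_simps ratio_def[of u v])
  also have "v * (a * (u / v) + b) = a * u + b * v" using False by (simp add: field_simps)
  also have "v * (c * (u / v) + d) = c * u + d * v" using False by (simp add: field_simps)
  finally show ?thesis .
qed

lemma ratio_eqI:
  assumes "x1 \<noteq> 0 \<or> x2 \<noteq> 0" "y1 \<noteq> 0 \<or> y2 \<noteq> 0" "x1 * y2 = y1 * x2"
  shows "ratio x1 x2 = ratio y1 y2"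
  using assms by (auto simp: ratio_def field_simps)

lemma moebius_comp:
  assumes "a' * d' \<noteq> b' * c'"
  shows "moebius a b c d \<circ> moebius a' b' c' d'
    = moebius (a * a' + b * c') (a * b' + b * d') (c * a' + d * c') (c * b' + d * d')"
proof
  fix p
  show "(moebius a b c d \<circ> moebius a' b' c' d') p
      = moebius (a * a' + b * c') (a * b' + b * d') (c * a' + d * c') (c * b' + d * d') p"
  proof (cases p)
    case None
    have "a' \<noteq> 0 \<or> c' \<noteq> 0" using assms by auto
    then show ?thesis using moebius_ratio[of a' c' a b c d] None by (simp add: moebius_simps)
  next
    case (Some x)
    have nz: "a' * x + b' \<noteq> 0 \<or> c' * x + d' \<noteq> 0"
    proof (rule ccontr)
      assume "\<not> ?thesis"
      then have "a' * x = - b'" "c' * x = - d'" by (auto simp: eq_neg_iff_add_eq_0)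
      then have "(a' * x) * d' = (c' * x) * b'" by simp
      then have "x * (a' * d' - b' * c') = 0" by (simp add: algebra_simps)
      then have "x = 0" using assms by simp
      then show False using \<open>a' * x = - b'\<close> \<open>c' * x = - d'\<close> assms by simp
    qed
    show ?thesis
      using moebius_ratio[OF nz, of a b c d] Some
      by (simp add: moebius_simps) (simp add: algebra_simps)
  qed
qed

lemma moebius_scalar: "a \<noteq> 0 \<Longrightarrow> moebius a 0 0 a = id"
  by (rule ext) (auto simp: moebius_def ratio_def split: option.split)

text \<open>
  In characteristic two, the sum of an odd number of copies of \<open>\<beta>\<close> is \<open>\<beta>\<close>, so the map fixes the
  sum \<open>\<sigma>\<close> of the elements of \<open>B\<close>. It is therefore multiplication by \<open>\<alpha>\<close> around \<open>\<sigma>\<close>. The product of the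
  differences \<open>x - \<sigma>\<close> over the elements \<open>x \<noteq> \<sigma>\<close> of \<open>B\<close> is invariant and nonzero, hence a small power of
  \<open>\<alpha>\<close> is 1.
\<close>

lemma affine_fixing_odd_set:
  fixes \<alpha> \<beta> :: "'k::field"
  assumes two: "(2 :: 'k) = 0" and B: "card B = 3 \<or> card B = 5"
    and im: "(\<lambda>x. \<alpha> * x + \<beta>) ` B = B" and \<alpha>: "\<alpha> \<noteq> 0"
    and roots: "\<And>n. n \<in> {2, 3, 4, 5} \<Longrightarrow> \<alpha> ^ n = 1 \<Longrightarrow> \<alpha> = 1"
  shows "\<alpha> = 1 \<and> \<beta> = 0"
proof -
  have fin: "finite B" using B by (auto intro: card_ge_0_finite)
  have inj: "inj_on (\<lambda>x. \<alpha> * x + \<beta>) A" for A using \<alpha> by (auto simp: inj_on_def)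
  have "of_nat (card B) = (1 :: 'k)"
  proof -
    have "(3 :: 'k) = 2 + 1" "(5 :: 'k) = 2 * 2 + 1" by simp_all
    then show ?thesis using B two by (metis add_0 mult_zero_left of_nat_numeral)
  qed
  moreover define \<sigma> where "\<sigma> = (\<Sum>x\<in>B. x)"
  moreover have "\<sigma> = (\<Sum>x\<in>B. \<alpha> * x + \<beta>)"
    using sum.reindex[OF inj, of "\<lambda>x. x" B] im by (simp add: \<sigma>_def)
  ultimately have \<sigma>: "\<alpha> * \<sigma> + \<beta> = \<sigma>"
    by (simp add: sum.distrib sum_distrib_left[symmetric])
  define C where "C = B - {\<sigma>}"
  have imC: "(\<lambda>x. \<alpha> * x + \<beta>) ` C = C"
    unfolding C_def using inj_on_image_set_diff[OF inj[of UNIV], of B "{\<sigma>}"] im \<sigma> by simp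
  have "(\<Prod>x\<in>C. x - \<sigma>) = (\<Prod>x\<in>C. (\<alpha> * x + \<beta>) - \<sigma>)"
    using prod.reindex[OF inj, of "\<lambda>x. x - \<sigma>" C] imC by simp
  also have "\<dots> = (\<Prod>x\<in>C. \<alpha> * (x - \<sigma>))"
  proof (rule prod.cong)
    fix x
    have "\<alpha> * x + \<beta> - \<sigma> = \<alpha> * x + \<beta> - (\<alpha> * \<sigma> + \<beta>)" by (simp only: \<sigma>)
    then show "\<alpha> * x + \<beta> - \<sigma> = \<alpha> * (x - \<sigma>)" by (simp add: algebra_simps)
  qed simp
  also have "\<dots> = \<alpha> ^ card C * (\<Prod>x\<in>C. x - \<sigma>)" by (simp add: prod.distrib)
  finally have "\<alpha> ^ card C = 1"
    using fin by (auto simp: C_def)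
  moreover have "card C \<in> {2, 3, 4, 5}"
    using B fin by (auto simp: C_def card_Diff_singleton_if)
  ultimately have "\<alpha> = 1" using roots by blast
  then show ?thesis using \<sigma> by simp
qed

text \<open>
  The multiplier of an affine map that preserves a set of 3 or 5 elements is a root of unity of order at
  most 5, which \<open>roots\<close> forces to be 1. In characteristic two the condition on sums
  covers differences.
\<close>

locale finite_field_char_2 =
  fixes F :: "'k::field set"
  assumes two: "(2 :: 'k) = 0"
    and card_F: "card F \<ge> 32"
    and closed: "0 \<in> F" "1 \<in> F" "\<And>x y. x \<in> F \<Longrightarrow> y \<in> F \<Longrightarrow> x + y \<in> F"
      "\<And>x y. x \<in> F \<Longrightarrow> y \<in> F \<Longrightarrow> x * y \<in> F" "\<And>x y. x \<in> F \<Longrightarrow> y \<in> F \<Longrightarrow> x / y \<in> F"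
    and roots: "\<And>x n. x \<in> F \<Longrightarrow> x \<noteq> 0 \<Longrightarrow> n \<in> {2, 3, 4, 5} \<Longrightarrow> x ^ n = 1 \<Longrightarrow> x = 1"
begin

definition proj_line :: "'k option set" where
  "proj_line = insert None (Some ` F)"

definition PGL :: "('k option \<Rightarrow> 'k option) set" where
  "PGL = {moebius a b c d | a b c d. a \<in> F \<and> b \<in> F \<and> c \<in> F \<and> d \<in> F \<and> a * d \<noteq> b * c}"

lemma finite_F: "finite F"
  using card_F by (auto intro: card_ge_0_finite)

lemma uminus_eq: "- x = (x :: 'k)"
proof -
  have "x + x = 2 * x" by simp
  then have "x + x = 0" using two by simp
  then show ?thesis by (rule minus_unique)
qed

lemma diff_closed: "x \<in> F \<Longrightarrow> y \<in> F \<Longrightarrow> x - y \<in> F"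
  unfolding diff_conv_add_uminus uminus_eq by (rule closed(3))

lemma uminus_closed: "x \<in> F \<Longrightarrow> - x \<in> F"
  by (simp only: uminus_eq)

lemma ratio_mem: "u \<in> F \<Longrightarrow> v \<in> F \<Longrightarrow> ratio u v \<in> proj_line"
  using closed by (auto simp: ratio_def proj_line_def)

lemma proj_line_cases:
  assumes "p \<in> proj_line"
  obtains u v where "u \<in> F" "v \<in> F" "u \<noteq> 0 \<or> v \<noteq> 0" "p = ratio u v"
proof (cases p)
  case None
  then show thesis using that[of 1 0] closed by (simp add: ratio_def)
next
  case (Some x)
  then show thesis using that[of x 1] assms closed by (auto simp: ratio_def proj_line_def)
qed

lemma PGL_I: "a \<in> F \<Longrightarrow> b \<in> F \<Longrightarrow> c \<in> F \<Longrightarrow> d \<in> F \<Longrightarrow> a * d \<noteq> b * c \<Longrightarrow> moebius a b c d \<in> PGL"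
  unfolding PGL_def by blast

lemma PGL_E:
  assumes "g \<in> PGL"
  obtains a b c d where "a \<in> F" "b \<in> F" "c \<in> F" "d \<in> F" "a * d \<noteq> b * c" "g = moebius a b c d"
  using assms unfolding PGL_def by blast

lemma PGL_id: "id \<in> PGL"
  using PGL_I[of 1 0 0 1] closed moebius_scalar[of "1 :: 'k"] by simp

lemma PGL_comp:
  assumes "g \<in> PGL" "h \<in> PGL"
  shows "g \<circ> h \<in> PGL"
proof -
  obtain a b c d where g: "a \<in> F" "b \<in> F" "c \<in> F" "d \<in> F" "a * d \<noteq> b * c" "g = moebius a b c d"
    using assms(1) by (rule PGL_E)
  obtain a' b' c' d' where h: "a' \<in> F" "b' \<in> F" "c' \<in> F" "d' \<in> F" "a' * d' \<noteq> b' * c'" "h = moebius a' b' c' d'"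
    using assms(2) by (rule PGL_E)
  have "(a * a' + b * c') * (c * b' + d * d') - (a * b' + b * d') * (c * a' + d * c')
      = (a * d - b * c) * (a' * d' - b' * c')" by (simp add: algebra_simps)
  also have "\<dots> \<noteq> 0" using g(5) h(5) by simp
  finally have "(a * a' + b * c') * (c * b' + d * d') \<noteq> (a * b' + b * d') * (c * a' + d * c')" by simp
  then show ?thesis unfolding g(6) h(6) moebius_comp[OF h(5)]
    using g h closed by (intro PGL_I) auto
qed

lemma PGL_inverse:
  assumes "g \<in> PGL"
  shows "\<exists>h\<in>PGL. g \<circ> h = id \<and> h \<circ> g = id"
proof -
  obtain a b c d where g: "a \<in> F" "b \<in> F" "c \<in> F" "d \<in> F" "a * d \<noteq> b * c" "g = moebius a b c d"
    using assms by (rule PGL_E)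
  let ?h = "moebius d (- b) (- c) a"
  have det: "d * a \<noteq> (- b) * (- c)" using g(5) by (simp add: mult.commute)
  have "?h \<in> PGL" using g det uminus_closed by (intro PGL_I) auto
  moreover have "g \<circ> ?h = moebius (a * d - b * c) 0 0 (a * d - b * c)"
    unfolding g(6) moebius_comp[OF det] by (simp add: algebra_simps)
  moreover have "?h \<circ> g = moebius (a * d - b * c) 0 0 (a * d - b * c)"
    unfolding g(6) moebius_comp[OF g(5)] by (simp add: algebra_simps)
  ultimately show ?thesis using g(5) moebius_scalar[of "a * d - b * c"] by auto
qed

lemma PGL_proj_line: "g \<in> PGL \<Longrightarrow> p \<in> proj_line \<Longrightarrow> g p \<in> proj_line"
  by (elim PGL_E proj_line_cases) (simp add: moebius_ratio ratio_mem closed)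

lemma PGL_bij: "g \<in> PGL \<Longrightarrow> bij g"
  using PGL_inverse o_bij by blast

lemma PGL_undo: "g \<in> PGL \<Longrightarrow> undo g \<in> PGL"
  using PGL_inverse inv_unique_comp by metis

lemma PGL_image_proj_line:
  assumes g: "g \<in> PGL"
  shows "g ` proj_line = proj_line"
proof
  show "proj_line \<subseteq> g ` proj_line"
  proof
    fix p assume "p \<in> proj_line"
    then have "undo g p \<in> proj_line" using PGL_proj_line[OF PGL_undo[OF g]] by blast
    moreover have "p = g (undo g p)"
      using PGL_bij[OF g] by (simp add: bij_is_surj surj_f_inv_f)
    ultimately show "p \<in> g ` proj_line" by (rule rev_image_eqI)
  qed
qed (use PGL_proj_line[OF g] in auto)

text \<open>
  Writing \<open>[z, x]\<close> for the determinant of the homogeneous coordinates of two points, which vanishes only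
  for equal points, the required map takes \<open>w\<close> to the cross-ratio with homogeneous coordinates
  \<open>[z, x] * [w, y]\<close> and \<open>[z, y] * [w, x]\<close>.
\<close>

lemma PGL_standardize:
  assumes xs: "xs \<in> frames proj_line"
  obtains g where "g \<in> PGL" "map g xs = [None, Some 0, Some 1]"
proof -
  obtain x y z where xyz: "xs = [x, y, z]"
    using xs by (auto simp: frames_def numeral_3_eq_3 length_Suc_conv)
  then have ne: "x \<noteq> y" "z \<noteq> x" "z \<noteq> y" and mem: "x \<in> proj_line" "y \<in> proj_line" "z \<in> proj_line"
    using xs by (auto simp: frames_def)
  obtain x1 x2 where x: "x1 \<in> F" "x2 \<in> F" "x1 \<noteq> 0 \<or> x2 \<noteq> 0" "x = ratio x1 x2" by (rule proj_line_cases[OF mem(1)])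
  obtain y1 y2 where y: "y1 \<in> F" "y2 \<in> F" "y1 \<noteq> 0 \<or> y2 \<noteq> 0" "y = ratio y1 y2" by (rule proj_line_cases[OF mem(2)])
  obtain z1 z2 where z: "z1 \<in> F" "z2 \<in> F" "z1 \<noteq> 0 \<or> z2 \<noteq> 0" "z = ratio z1 z2" by (rule proj_line_cases[OF mem(3)])
  define zx where "zx = z1 * x2 - x1 * z2"
  define zy where "zy = z1 * y2 - y1 * z2"
  define xy where "xy = x1 * y2 - y1 * x2"
  have nz: "zx \<noteq> 0" "zy \<noteq> 0" "xy \<noteq> 0"
    using ratio_eqI[OF z(3) x(3)] ratio_eqI[OF z(3) y(3)] ratio_eqI[OF x(3) y(3)] ne x(4) y(4) z(4)
    by (auto simp: zx_def zy_def xy_def)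
  define g where "g = moebius (zx * y2) (- (zx * y1)) (zy * x2) (- (zy * x1))"
  have "zx \<in> F" "zy \<in> F" using x y z closed diff_closed by (auto simp: zx_def zy_def)
  moreover have "(zx * y2) * (- (zy * x1)) \<noteq> (- (zx * y1)) * (zy * x2)"
  proof
    assume "(zx * y2) * (- (zy * x1)) = (- (zx * y1)) * (zy * x2)"
    then have "zx * zy * xy = 0" by (simp add: xy_def algebra_simps)
    then show False using nz by simp
  qed
  ultimately have "g \<in> PGL"
    unfolding g_def using x y closed uminus_closed by (intro PGL_I) auto
  moreover have "g x = None"
    unfolding g_def x(4) moebius_ratio[OF x(3)] by (simp add: ratio_def)
  moreover have "g y = Some 0"
  proof -
    have "zy * x2 * y1 + - (zy * x1) * y2 = - (zy * xy)" by (simp add: xy_def algebra_simps)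
    then have "zy * x2 * y1 + - (zy * x1) * y2 \<noteq> 0" using nz by simp
    then show ?thesis unfolding g_def y(4) moebius_ratio[OF y(3)] by (simp add: ratio_def)
  qed
  moreover have "g z = Some 1"
  proof -
    have "zx * y2 * z1 + - (zx * y1) * z2 = zx * zy" "zy * x2 * z1 + - (zy * x1) * z2 = zx * zy"
      by (simp_all add: zx_def zy_def algebra_simps)
    then show ?thesis unfolding g_def z(4) moebius_ratio[OF z(3)] using nz by (simp add: ratio_def)
  qed
  ultimately show thesis using that xyz by simp
qed

lemma PGL_fix_infinity:
  assumes g: "g \<in> PGL" and fixed: "g None = None"
  obtains \<alpha> \<beta> where "\<alpha> \<in> F" "\<alpha> \<noteq> 0" "\<And>x. g (Some x) = Some (\<alpha> * x + \<beta>)"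
proof -
  obtain a b c d where abcd: "a \<in> F" "b \<in> F" "c \<in> F" "d \<in> F" "a * d \<noteq> b * c" "g = moebius a b c d"
    using g by (rule PGL_E)
  have c: "c = 0" using fixed abcd(6) by (simp add: moebius_simps ratio_def split: if_splits)
  then have "a \<noteq> 0" "d \<noteq> 0" using abcd(5) by auto
  then show thesis
    using abcd c closed(5)[of a d]
    by (intro that[of "a / d" "b / d"]) (auto simp: moebius_simps ratio_def add_divide_distrib)
qed

lemma PGL_affine_id:
  assumes "g None = None" "\<And>x. g (Some x) = Some ((1 :: 'k) * x + 0)"
  shows "g = id"
proof
  fix p show "g p = id p" using assms by (cases p) auto
qed

lemma PGL_fix_frame:
  assumes g: "g \<in> PGL" and fixed: "map g [None, Some 0, Some 1] = [None, Some 0, Some 1]"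
  shows "g = id"
proof -
  obtain \<alpha> \<beta> where ab: "\<alpha> \<in> F" "\<alpha> \<noteq> 0" "\<And>x. g (Some x) = Some (\<alpha> * x + \<beta>)"
    using PGL_fix_infinity[OF g] fixed by auto
  have "\<beta> = 0" "\<alpha> = 1" using ab(3)[of 0] ab(3)[of 1] fixed by auto
  then show ?thesis using PGL_affine_id[of g] ab(3) fixed by simp
qed

text \<open>
  Both frames are moved to infinity, 0, 1; an affine map that fixes 0 and 1 is the identity.
\<close>

lemma PGL_sharp:
  assumes xs: "xs \<in> frames proj_line" and ys: "ys \<in> frames proj_line"
  shows "\<exists>!g. g \<in> PGL \<and> map g xs = ys"
proof -
  obtain h where h: "h \<in> PGL" "map h xs = [None, Some 0, Some 1]" by (rule PGL_standardize[OF xs])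
  obtain k where k: "k \<in> PGL" "map k ys = [None, Some 0, Some 1]" by (rule PGL_standardize[OF ys])
  have uh: "undo h (h p) = p" "h (undo h p) = p" and uk: "undo k (k p) = p" "k (undo k p) = p" for p
    using PGL_bij[OF h(1)] PGL_bij[OF k(1)]
    by (simp_all add: bij_is_inj bij_is_surj surj_f_inv_f)
  have undo_k: "map (undo k) [None, Some 0, Some 1] = ys"
    unfolding k(2)[symmetric] by (simp add: uk map_idI)
  show ?thesis
  proof (rule ex1I[of _ "undo k \<circ> h"])
    show "undo k \<circ> h \<in> PGL \<and> map (undo k \<circ> h) xs = ys"
      using PGL_comp[OF PGL_undo[OF k(1)] h(1)] undo_k h(2) by (simp add: map_map[symmetric] del: map_map)
  next
    fix g assume g: "g \<in> PGL \<and> map g xs = ys"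
    have xs': "map (undo h) [None, Some 0, Some 1] = xs"
      unfolding h(2)[symmetric] by (simp add: uh map_idI)
    have "map (k \<circ> (g \<circ> undo h)) [None, Some 0, Some 1] = map k (map g (map (undo h) [None, Some 0, Some 1]))"
      by (simp only: map_map)
    also have "\<dots> = [None, Some 0, Some 1]" unfolding xs' using g k(2) by simp
    finally have "k \<circ> (g \<circ> undo h) = id"
      using g h(1) k(1) PGL_comp PGL_undo by (intro PGL_fix_frame) blast+
    then have e: "k (g (undo h p)) = p" for p by (metis comp_apply id_apply)
    show "g = undo k \<circ> h"
    proof
      fix p
      have "k (g (undo h (h p))) = h p" by (rule e)
      then have "k (g p) = h p" by (simp only: uh)
      then have "undo k (k (g p)) = undo k (h p)" by (rule arg_cong)
      then show "g p = (undo k \<circ> h) p" by (simp add: uk)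
    qed
  qed
qed

lemma PGL_rigid_at_infinity:
  assumes g: "g \<in> PGL" and fixed: "g None = None"
    and A: "A \<subseteq> proj_line - {None}" "g ` A = A" "card A = 3 \<or> card A = 5"
  shows "g = id"
proof -
  obtain \<alpha> \<beta> where ab: "\<alpha> \<in> F" "\<alpha> \<noteq> 0" "\<And>x. g (Some x) = Some (\<alpha> * x + \<beta>)"
    by (rule PGL_fix_infinity[OF g fixed]) blast
  define B where "B = {x. Some x \<in> A}"
  have AB: "A = Some ` B" using A(1) by (auto simp: B_def proj_line_def)
  have "Some ` ((\<lambda>x. \<alpha> * x + \<beta>) ` B) = g ` (Some ` B)" by (simp add: image_image ab(3))
  also have "\<dots> = Some ` B" using A(2) AB by simp
  finally have "(\<lambda>x. \<alpha> * x + \<beta>) ` B = B" by (simp add: inj_image_eq_iff)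
  moreover have "card B = card A" unfolding AB by (simp add: card_image)
  ultimately have "\<alpha> = 1 \<and> \<beta> = 0"
    using A(3) roots[OF ab(1,2)] by (intro affine_fixing_odd_set[OF two _ _ ab(2), of B]) auto
  then show ?thesis using PGL_affine_id[of g] ab(3) fixed by simp
qed

text \<open>Conjugation moves the fixed point to infinity.\<close>

lemma PGL_rigid:
  assumes g: "g \<in> PGL" and p: "p \<in> proj_line" "g p = p"
    and A: "A \<subseteq> proj_line - {p}" "g ` A = A" "card A = 3 \<or> card A = 5"
  shows "g = id"
proof -
  have "\<exists>h\<in>PGL. h p = None"
  proof -
    have "card (proj_line - {p}) \<ge> 3"
      using p(1) card_F finite_F by (simp add: proj_line_def card_image card_insert_if card_Diff_singleton_if)
    then obtain C where C: "C \<subseteq> proj_line - {p}" "card C = 2"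
      by (metis obtain_subset_with_card_n numeral_3_eq_3 numeral_2_eq_2 Suc_leD)
    then obtain u v where "C = {u, v}" "u \<noteq> v" by (auto simp: card_2_iff)
    then have "[p, u, v] \<in> frames proj_line" using C p by (auto simp: frames_def)
    then obtain h where "h \<in> PGL" "map h [p, u, v] = [None, Some 0, Some 1]" by (rule PGL_standardize)
    then show ?thesis by auto
  qed
  then obtain h where h: "h \<in> PGL" "h p = None" by blast
  have bij: "bij h" using PGL_bij[OF h(1)] .
  have uh: "undo h (h x) = x" "h (undo h x) = x" for x
    using bij by (simp_all add: bij_is_inj bij_is_surj surj_f_inv_f)
  have "h \<circ> (g \<circ> undo h) = id"
  proof (rule PGL_rigid_at_infinity[where A = "h ` A"])
    show "h \<circ> (g \<circ> undo h) \<in> PGL" using g h(1) PGL_comp PGL_undo by blast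
    have "undo h None = p" using uh(1)[of p] h(2) by simp
    then show "(h \<circ> (g \<circ> undo h)) None = None" using p(2) h(2) by simp
    have "h ` A \<subseteq> proj_line" using A(1) PGL_proj_line[OF h(1)] by blast
    moreover have "None \<notin> h ` A"
    proof
      assume "None \<in> h ` A"
      then obtain x where "x \<in> A" "h x = h p" using h(2) by auto
      then have "p \<in> A" using bij by (metis bij_is_inj inj_eq)
      then show False using A(1) by blast
    qed
    ultimately show "h ` A \<subseteq> proj_line - {None}" by blast
    have "(h \<circ> (g \<circ> undo h)) ` (h ` A) = h ` (g ` A)" by (simp add: image_comp o_def uh)
    then show "(h \<circ> (g \<circ> undo h)) ` (h ` A) = h ` A" using A(2) by simp
    show "card (h ` A) = 3 \<or> card (h ` A) = 5"
      using A(3) bij by (metis bij_is_inj card_image inj_on_subset subset_UNIV)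
  qed
  then have e: "h (g (undo h x)) = x" for x by (metis comp_apply id_apply)
  show ?thesis
  proof
    fix x
    have "h (g (undo h (h x))) = h x" by (rule e)
    then have "undo h (h (g x)) = undo h (h x)" by (simp only: uh)
    then show "g x = id x" by (simp only: uh id_apply)
  qed
qed

lemma card_proj_line: "card proj_line = card F + 1"
  using finite_F by (simp add: proj_line_def card_image card_insert_if)

sublocale sharply_3_transitive proj_line PGL
proof
  show "finite proj_line" using finite_F by (simp add: proj_line_def)
  show "33 \<le> card proj_line" using card_proj_line card_F by simp
qed (rule PGL_bij PGL_image_proj_line PGL_id PGL_comp PGL_undo PGL_sharp PGL_rigid; assumption)+

end

text \<open>
  For odd \<open>f\<close>, an element \<open>x\<close> of the field with \<open>2 ^ f\<close> elements with \<open>x ^ n = 1\<close> and \<open>2 \<le> n \<le> 5\<close> equals 1,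
  because \<open>n\<close> is coprime to the order \<open>2 ^ f - 1\<close> of the multiplicative group; so the group of
  fractional linear maps is rigid. The bound \<open>f \<ge> 5\<close> provides the required 33 points.
\<close>

theorem theorem3p4:
  fixes f m :: nat
  assumes "f > 3"
    and "gcd f 6 = 1"
    and "m \<in> {5, 30, 35, 45, 50, 75, 80}"
  shows "\<exists>(X :: nat set) (B :: nat set multiset).
           is_design 3 (2 * (2 ^ f + 1)) 6 ((2 ^ f - 1) * m) X B \<and> simple_blocks B"
proof -
  have odd: "odd f"
  proof
    assume "even f"
    then have "2 dvd gcd f 6" by simp
    then show False using assms(2) by simp
  qed
  then have "f \<noteq> 4" by auto
  then have f5: "f \<ge> 5" using assms(1) by simp
  have "(2 :: bit alg_closure) = to_ac 2" by (simp only: to_ac_numeral)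
  then have two: "(2 :: bit alg_closure) = 0" by simp
  have f0: "f > 0" using f5 by simp
  define F :: "bit alg_closure set" where "F = frobenius_field (2 ^ f)"
  note F_closed = frobenius_field_closed[OF two, where f = f, folded F_def]
  have card: "card F = 2 ^ f"
    unfolding F_def using card_frobenius_field[OF two f0] .
  interpret finite_field_char_2 F
  proof
    have "32 = (2 :: nat) ^ 5" by simp
    also have "\<dots> \<le> 2 ^ f" using f5 by (rule power_increasing) simp
    finally show "32 \<le> card F" unfolding card .
  next
    fix x and n :: nat
    assume x: "x \<in> F" "x \<noteq> 0" and n: "n \<in> {2, 3, 4, 5}" and xn: "x ^ n = 1"
    have "x * x ^ (2 ^ f - 1) = x ^ Suc (2 ^ f - 1)" by (simp only: power_Suc)
    also have "\<dots> = x ^ 2 ^ f" by simp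
    also have "\<dots> = x" using x(1) unfolding F_def frobenius_field_def by blast
    finally have "x ^ (2 ^ f - 1) = 1" using x(2) by simp
    then show "x = 1"
      using power_eq_1_coprime[OF xn] coprime_two_power_minus_1[OF odd] n by blast
  qed (rule two F_closed; assumption)+
  obtain k where k: "m = 5 * k" "k \<le> 16"
  proof
    show "m = 5 * (m div 5)" "m div 5 \<le> 16" using assms(3) by auto
  qed
  have "card proj_line = 2 ^ f + 1" using card_proj_line card by simp
  then have "2 * card proj_line = 2 * (2 ^ f + 1)" "card proj_line - 2 = 2 ^ f - 1" by simp_all
  then show ?thesis using doubled_orbit_design[OF k(2)] unfolding k(1) by (simp only:)
qed

end
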